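(* Let $(\{(A_t,L_t)\},\Gamma)$ be a continuous field of compact quantum metric spaces over a locally compact Hausdorff space $T$. Let $R\ge0$. Let $t_0\in T$, and let $\{f_n\}_{n\in\mathbb{N}}$ be a sequence in $\Gamma$ such that $(f_n)_{t_0}\in\mathcal{D}_R(A_{t_0})$ for each $n\in\mathbb{N}$ and the set $\{(f_n)_{t_0}:n\in\mathbb{N}\}$ is dense in $\mathcal{D}_R(A_{t_0})$. Then the following are equivalent: (i) $\mathrm{dist}^R_{\mathrm{oq}}(A_t,A_{t_0})\to0$ as $t\to t_0$; (ii) $\mathrm{dist}_{\mathrm{GH}}(\mathcal{D}_R(A_t),\mathcal{D}_R(A_{t_0}))\to0$ as $t\to t_0$; (iii) for any $\varepsilon>0$ there is an $N$ such that the open $\varepsilon$-balls in $A_t$ centered at $(f_1)_t,\dots,(f_N)_t$ cover $\mathcal{D}_R(A_t)$ for all $t$ in some neighborhood $\mathcal{U}$ of $t_0$.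
   Context: An order-unit space is a real partially ordered vector space $A$ with a distinguished element $e=e_A$ (the order unit) such that (i) for each $a\in A$ there is $r\in\mathbb{R}$ with $a\le re$; (ii) if $a\le re$ for all real $r>0$ then $a\le 0$. Its norm is $\|a\|=\inf\{r\in\mathbb{R}:-re\le a\le re\}$. A state is a $\mu$ in the dual $A'$ with $\mu(e)=\|\mu\|'=1$; $S(A)$ is the (nonempty) set of states with the weak-$*$ topology. For a seminorm $L$ on $A$ put $\rho_L(\mu,\nu)=\sup\{|\mu(a)-\nu(a)|:a\in A,\ L(a)\le1\}$. $L$ is a Lip-norm, and $(A,L)$ is a compact quantum metric space, if (1) $L(a)=0$ if and only if $a\in\mathbb{R}e$; (2) the topology on $S(A)$ induced by $\rho_L$ is the weak-$*$ topology. For $r\ge0$ let $\mathcal{D}_r(A)=\{a\in A:L(a)\le1,\ \|a\|\le r\}$, with the metric induced by the norm. $\mathrm{dist}_{\mathrm{H}}^X$ is the Hausdorff distance between nonempty subsets of a metric space $X$. $\mathrm{dist}_{\mathrm{GH}}(X,Y)=\inf\{\mathrm{dist}_{\mathrm{H}}^Z(h_X(X),h_Y(Y))\}$ over isometric embeddings $h_X,h_Y$ of $X,Y$ into a common metric space $Z$ (Gromov-Hausdorff distance). For $R\ge0$, $$\mathrm{dist}^R_{\mathrm{oq}}(A,B)=\inf\max\big(\mathrm{dist}_{\mathrm{H}}^V(h_A(\mathcal{D}_R(A)),h_B(\mathcal{D}_R(B))),\ \|h_A(Re_A)-h_B(Re_B)\|\big),$$ the infimum being over all triples $(V,h_A,h_B)$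 of a real normed space $V$ and linear isometric embeddings $h_A:A\to V$, $h_B:B\to V$. A continuous field of (real) Banach spaces over $T$ is a family $\{E_t\}_{t\in T}$ of Banach spaces with a linear subspace $\Gamma\subseteq\prod_tE_t$ (the continuous sections) such that: $\{f_t:f\in\Gamma\}$ is dense in $E_t$ for every $t$; $t\mapsto\|f_t\|$ is continuous for $f\in\Gamma$; and any $f\in\prod_tE_t$ that can, near each point of $T$ and for each $\varepsilon>0$, be approximated uniformly within $\varepsilon$ by an element of $\Gamma$ belongs to $\Gamma$. A continuous field of order-unit spaces is such a field in which each $E_t$ is a complete order-unit space with its order-unit norm and the unit section $t\mapsto e_{E_t}$ is in $\Gamma$. A continuous field of compact quantum metric spaces over $T$ consists of a compact quantum metric space $(A_t,L_t)$, with norm completion $\overline{A_t}$, for each $t\in T$, and the set $\Gamma$ of continuous sections of a continuous field of order-unit spaces over $T$ with fibres $\overline{A_t}$, such that for every $t\in T$, $a\in A_t$ and $\varepsilon>0$ there is $f\in\Gamma^L_t$ with $\|f_t-a\|<\varepsilon$ and $L_t(f_t)<L_t(a)+\varepsilon$. Here $L_t=+\infty$ on $\overline{A_t}\setminus A_t$, and $\Gamma^L_{t_0}$ is the set of $f\in\Gamma$ for which $t\mapsto L_t(f_t)$ is upper semi-continuous at $t_0$. In (iii), the centers $(f_n)_t$ lie in $\overline{A_t}$ and the balls are taken with respect to its norm. *)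

theory Defs
  imports "HOL-Analysis.Analysis"
begin

text \<open>
  Spaces that vary over a base are carried by linear subspaces of one real vector space \<open>'v\<close>,
  each with its own order, unit and norm; the operations of \<open>'v\<close> are the only common structure.
  This loses no generality, since a family of real vector spaces embeds in its direct sum.
  Functions and relations on a carrier are unconstrained outside it.
\<close>

section \<open>Normed spaces on a carrier\<close>

definition linear_on_carrier ::
    "'a::real_vector set \<Rightarrow> ('a \<Rightarrow> 'b::real_vector) \<Rightarrow> bool" where
  "linear_on_carrier C h \<longleftrightarrow>
     (\<forall>x\<in>C. \<forall>y\<in>C. h (x + y) = h x + h y) \<and> (\<forall>c. \<forall>x\<in>C. h (c *\<^sub>R x) = c *\<^sub>R h x)"

definition seminorm_on :: "'a::real_vector set \<Rightarrow> ('a \<Rightarrow> real) \<Rightarrow> bool" where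
  "seminorm_on C p \<longleftrightarrow>
     (\<forall>x\<in>C. 0 \<le> p x) \<and> (\<forall>x\<in>C. \<forall>y\<in>C. p (x + y) \<le> p x + p y) \<and>
     (\<forall>c. \<forall>x\<in>C. p (c *\<^sub>R x) = \<bar>c\<bar> * p x)"

definition normed_space_on :: "'a::real_vector set \<Rightarrow> ('a \<Rightarrow> real) \<Rightarrow> bool" where
  "normed_space_on C N \<longleftrightarrow> subspace C \<and> seminorm_on C N \<and> (\<forall>x\<in>C. N x = 0 \<longrightarrow> x = 0)"

text \<open>
  The metric is cut off outside the carrier because the locale \<open>Metric_space\<close> wants symmetry and
  nonnegativity on the whole type.
\<close>
definition banach_space_on :: "'a::real_vector set \<Rightarrow> ('a \<Rightarrow> real) \<Rightarrow> bool" where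
  "banach_space_on C N \<longleftrightarrow> normed_space_on C N \<and>
     Metric_space.mcomplete C (\<lambda>x y. if x \<in> C \<and> y \<in> C then N (x - y) else 0)"


section \<open>Order-unit spaces\<close>

record 'v ou_space =
  ou_carrier :: "'v set"
  ou_le :: "'v \<Rightarrow> 'v \<Rightarrow> bool"
  ou_unit :: 'v

definition ordered_vector_space_on :: "'v::real_vector set \<Rightarrow> ('v \<Rightarrow> 'v \<Rightarrow> bool) \<Rightarrow> bool" where
  "ordered_vector_space_on C le \<longleftrightarrow> subspace C \<and>
     (\<forall>x\<in>C. le x x) \<and>
     (\<forall>x\<in>C. \<forall>y\<in>C. le x y \<and> le y x \<longrightarrow> x = y) \<and>
     (\<forall>x\<in>C. \<forall>y\<in>C. \<forall>z\<in>C. le x y \<and> le y z \<longrightarrow> le x z) \<and>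
     (\<forall>x\<in>C. \<forall>y\<in>C. \<forall>z\<in>C. le x y \<longrightarrow> le (x + z) (y + z)) \<and>
     (\<forall>x\<in>C. \<forall>y\<in>C. \<forall>c\<ge>0. le x y \<longrightarrow> le (c *\<^sub>R x) (c *\<^sub>R y))"

text \<open>
  The unit is required to be positive and nonzero.  The two remaining axioms alone admit degenerate
  cases, such as the zero space or a negative unit, in which the order-unit norm is not defined
  and there is no state.
\<close>
definition order_unit_space :: "'v::real_vector ou_space \<Rightarrow> bool" where
  "order_unit_space A \<longleftrightarrow>
     ordered_vector_space_on (ou_carrier A) (ou_le A) \<and>
     ou_unit A \<in> ou_carrier A \<and> ou_le A 0 (ou_unit A) \<and> ou_unit A \<noteq> 0 \<and>
     (\<forall>a\<in>ou_carrier A. \<exists>r::real. ou_le A a (r *\<^sub>R ou_unit A)) \<and>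
     (\<forall>a\<in>ou_carrier A. (\<forall>r>0. ou_le A a (r *\<^sub>R ou_unit A)) \<longrightarrow> ou_le A a 0)"

definition ou_norm :: "'v::real_vector ou_space \<Rightarrow> 'v \<Rightarrow> real" where
  "ou_norm A a =
     Inf {r. ou_le A (- r *\<^sub>R ou_unit A) a \<and> ou_le A a (r *\<^sub>R ou_unit A)}"

definition complete_order_unit_space :: "'v::real_vector ou_space \<Rightarrow> bool" where
  "complete_order_unit_space E \<longleftrightarrow>
     order_unit_space E \<and> banach_space_on (ou_carrier E) (ou_norm E)"

text \<open>
  The norm completion, with \<open>A\<close> literally contained in \<open>E\<close>.  The order of \<open>E\<close> is determined by
  these conditions, because the positive cone of an order-unit space is closed and determined by
  the unit and the norm.
\<close>
definition ou_completion :: "'v::real_vector ou_space \<Rightarrow> 'v ou_space \<Rightarrow> bool" where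
  "ou_completion A E \<longleftrightarrow>
     order_unit_space A \<and> complete_order_unit_space E \<and>
     ou_carrier A \<subseteq> ou_carrier E \<and> ou_unit A = ou_unit E \<and>
     (\<forall>x\<in>ou_carrier A. \<forall>y\<in>ou_carrier A. ou_le A x y \<longleftrightarrow> ou_le E x y) \<and>
     (\<forall>x\<in>ou_carrier E. \<forall>\<epsilon>>0. \<exists>a\<in>ou_carrier A. ou_norm E (x - a) < \<epsilon>)"


section \<open>States and compact quantum metric spaces\<close>

definition dual_norm :: "'v::real_vector ou_space \<Rightarrow> ('v \<Rightarrow> real) \<Rightarrow> ennreal" where
  "dual_norm A \<mu> = (SUP a\<in>{a \<in> ou_carrier A. ou_norm A a \<le> 1}. ennreal \<bar>\<mu> a\<bar>)"

text \<open>
  Functionals are extensional, i.e. \<open>undefined\<close> outside the carrier, so that each state occurs only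
  once.  Continuity of \<open>\<mu>\<close> is contained in \<open>dual_norm A \<mu> = 1\<close>.
\<close>
definition states :: "'v::real_vector ou_space \<Rightarrow> ('v \<Rightarrow> real) set" where
  "states A = {\<mu> \<in> extensional (ou_carrier A).
     linear_on_carrier (ou_carrier A) \<mu> \<and> \<mu> (ou_unit A) = 1 \<and> dual_norm A \<mu> = 1}"

definition weak_star_topology :: "'v::real_vector ou_space \<Rightarrow> ('v \<Rightarrow> real) topology" where
  "weak_star_topology A =
     subtopology (product_topology (\<lambda>_. euclideanreal) (ou_carrier A)) (states A)"

definition lip_dist ::
    "'v::real_vector ou_space \<Rightarrow> ('v \<Rightarrow> real) \<Rightarrow> ('v \<Rightarrow> real) \<Rightarrow> ('v \<Rightarrow> real) \<Rightarrow> ennreal" where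
  "lip_dist A L \<mu> \<nu> = (SUP a\<in>{a \<in> ou_carrier A. L a \<le> 1}. ennreal \<bar>\<mu> a - \<nu> a\<bar>)"

text \<open>\<open>lip_dist\<close> may a priori be infinite, so its topology is spelled out instead of using \<open>mtopology\<close>.\<close>
definition lip_topology ::
    "'v::real_vector ou_space \<Rightarrow> ('v \<Rightarrow> real) \<Rightarrow> ('v \<Rightarrow> real) topology" where
  "lip_topology A L = topology (\<lambda>U. U \<subseteq> states A \<and>
     (\<forall>\<mu>\<in>U. \<exists>\<epsilon>>0. \<forall>\<nu>\<in>states A. lip_dist A L \<mu> \<nu> < \<epsilon> \<longrightarrow> \<nu> \<in> U))"

lemma openin_lip_topology:
  "openin (lip_topology A L) U \<longleftrightarrow> U \<subseteq> states A \<and>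
     (\<forall>\<mu>\<in>U. \<exists>\<epsilon>>0. \<forall>\<nu>\<in>states A. lip_dist A L \<mu> \<nu> < \<epsilon> \<longrightarrow> \<nu> \<in> U)"
proof -
  let ?O = "\<lambda>U. U \<subseteq> states A \<and>
     (\<forall>\<mu>\<in>U. \<exists>\<epsilon>>0. \<forall>\<nu>\<in>states A. lip_dist A L \<mu> \<nu> < \<epsilon> \<longrightarrow> \<nu> \<in> U)"
  have "?O (U \<inter> V)" if U: "?O U" and V: "?O V" for U V
  proof (intro conjI ballI)
    show "U \<inter> V \<subseteq> states A" using U by blast
  next
    fix \<mu> assume \<mu>: "\<mu> \<in> U \<inter> V"
    obtain d where d: "d > 0" "\<forall>\<nu>\<in>states A. lip_dist A L \<mu> \<nu> < d \<longrightarrow> \<nu> \<in> U"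
      using U \<mu> by blast
    obtain e where e: "e > 0" "\<forall>\<nu>\<in>states A. lip_dist A L \<mu> \<nu> < e \<longrightarrow> \<nu> \<in> V"
      using V \<mu> by blast
    show "\<exists>\<epsilon>>0. \<forall>\<nu>\<in>states A. lip_dist A L \<mu> \<nu> < \<epsilon> \<longrightarrow> \<nu> \<in> U \<inter> V"
      using d e by (intro exI[of _ "min d e"]) auto
  qed
  moreover have "?O (\<Union>\<K>)" if K: "\<forall>U\<in>\<K>. ?O U" for \<K>
  proof (intro conjI ballI)
    show "\<Union>\<K> \<subseteq> states A" using K by blast
  next
    fix \<mu> assume "\<mu> \<in> \<Union>\<K>"
    then obtain U where U: "U \<in> \<K>" "\<mu> \<in> U" by blast
    with K obtain d where "d > 0" "\<forall>\<nu>\<in>states A. lip_dist A L \<mu> \<nu> < d \<longrightarrow> \<nu> \<in> U"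
      by meson
    with U show "\<exists>\<epsilon>>0. \<forall>\<nu>\<in>states A. lip_dist A L \<mu> \<nu> < \<epsilon> \<longrightarrow> \<nu> \<in> \<Union>\<K>"
      by blast
  qed
  ultimately have "istopology ?O" unfolding istopology_def by blast
  then show ?thesis unfolding lip_topology_def by (simp add: topology_inverse')
qed

definition lip_norm :: "'v::real_vector ou_space \<Rightarrow> ('v \<Rightarrow> real) \<Rightarrow> bool" where
  "lip_norm A L \<longleftrightarrow> seminorm_on (ou_carrier A) L \<and>
     (\<forall>a\<in>ou_carrier A. L a = 0 \<longleftrightarrow> (\<exists>c. a = c *\<^sub>R ou_unit A)) \<and>
     lip_topology A L = weak_star_topology A"

definition compact_quantum_metric_space ::
    "'v::real_vector ou_space \<Rightarrow> ('v \<Rightarrow> real) \<Rightarrow> bool" where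
  "compact_quantum_metric_space A L \<longleftrightarrow> order_unit_space A \<and> lip_norm A L"

definition lip_ball :: "real \<Rightarrow> 'v::real_vector ou_space \<Rightarrow> ('v \<Rightarrow> real) \<Rightarrow> 'v set" where
  "lip_ball r A L = {a \<in> ou_carrier A. L a \<le> 1 \<and> ou_norm A a \<le> r}"


section \<open>Hausdorff, Gromov-Hausdorff and order-unit quantum Gromov-Hausdorff distance\<close>

definition dist_H :: "('a \<Rightarrow> 'a \<Rightarrow> real) \<Rightarrow> 'a set \<Rightarrow> 'a set \<Rightarrow> ennreal" where
  "dist_H d X Y = max (SUP x\<in>X. INF y\<in>Y. ennreal (d x y)) (SUP y\<in>Y. INF x\<in>X. ennreal (d x y))"

text \<open>
  The two infima below range over spaces carried by subsets of a fixed type.  Only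
  \<open>h\<^sub>X(X) \<union> h\<^sub>Y(Y)\<close> and \<open>h\<^sub>A(A) + h\<^sub>B(B)\<close> matter, and these fit into \<open>'a + 'b\<close> and \<open>'a \<times> 'b\<close>;
  the lemmas \<open>dist_GH_le\<close> and \<open>dist_oq_le\<close> show that spaces carried by any other type
  do not give smaller values.
\<close>
definition dist_GH ::
    "'a set \<Rightarrow> ('a \<Rightarrow> 'a \<Rightarrow> real) \<Rightarrow> 'b set \<Rightarrow> ('b \<Rightarrow> 'b \<Rightarrow> real) \<Rightarrow> ennreal" where
  "dist_GH X dX Y dY =
     Inf {dist_H d (hX ` X) (hY ` Y) | (Z :: ('a + 'b) set) d hX hY.
       Metric_space Z d \<and> hX ` X \<subseteq> Z \<and> hY ` Y \<subseteq> Z \<and>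
       (\<forall>x\<in>X. \<forall>x'\<in>X. d (hX x) (hX x') = dX x x') \<and>
       (\<forall>y\<in>Y. \<forall>y'\<in>Y. d (hY y) (hY y') = dY y y')}"

definition linear_isometric_embedding ::
    "'a::real_vector ou_space \<Rightarrow> 'b::real_vector set \<Rightarrow> ('b \<Rightarrow> real) \<Rightarrow> ('a \<Rightarrow> 'b) \<Rightarrow> bool" where
  "linear_isometric_embedding A V N h \<longleftrightarrow>
     h ` ou_carrier A \<subseteq> V \<and> linear_on_carrier (ou_carrier A) h \<and>
     (\<forall>a\<in>ou_carrier A. N (h a) = ou_norm A a)"

definition dist_oq ::
    "real \<Rightarrow> 'a::real_vector ou_space \<Rightarrow> ('a \<Rightarrow> real) \<Rightarrow> 'b::real_vector ou_space \<Rightarrow> ('b \<Rightarrow> real) \<Rightarrow> ennreal"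
  where
  "dist_oq R A LA B LB =
     Inf {max (dist_H (\<lambda>x y. N (x - y)) (hA ` lip_ball R A LA) (hB ` lip_ball R B LB))
              (ennreal (N (hA (R *\<^sub>R ou_unit A) - hB (R *\<^sub>R ou_unit B)))) |
          (V :: ('a \<times> 'b) set) N hA hB.
       normed_space_on V N \<and> linear_isometric_embedding A V N hA \<and>
       linear_isometric_embedding B V N hB}"

lemma dist_H_cong:
  assumes "\<And>x y. x \<in> X \<Longrightarrow> y \<in> Y \<Longrightarrow> d' (g x) (g y) = d x y"
  shows "dist_H d' (g ` X) (g ` Y) = dist_H d X Y"
proof -
  have "(INF y\<in>Y. ennreal (d' (g x) (g y))) = (INF y\<in>Y. ennreal (d x y))" if "x \<in> X" for x
    using assms that by (intro INF_cong) auto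
  moreover have "(INF x\<in>X. ennreal (d' (g x) (g y))) = (INF x\<in>X. ennreal (d x y))" if "y \<in> Y" for y
    using assms that by (intro INF_cong) auto
  ultimately show ?thesis
    unfolding dist_H_def image_image by (intro arg_cong2[of _ _ _ _ max] SUP_cong) auto
qed

lemma dist_GH_le:
  fixes Z :: "'w set"
  assumes Z: "Metric_space Z d" "hX ` X \<subseteq> Z" "hY ` Y \<subseteq> Z"
    and X: "\<forall>x\<in>X. \<forall>x'\<in>X. d (hX x) (hX x') = dX x x'"
    and Y: "\<forall>y\<in>Y. \<forall>y'\<in>Y. d (hY y) (hY y') = dY y y'"
  shows "dist_GH X dX Y dY \<le> dist_H d (hX ` X) (hY ` Y)"
proof -
  interpret Metric_space Z d by fact
  define W where "W = hX ` X \<union> hY ` Y"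
  define g where "g z = (if z \<in> hX ` X then Inl (inv_into X hX z) else Inr (inv_into Y hY z))" for z
  define p where "p = inv_into W g"
  have "inj_on g W"
    unfolding inj_on_def W_def g_def by (auto split: if_splits dest: inv_into_injective)
  then have p: "p (g z) = z" if "z \<in> W" for z
    unfolding p_def using that by simp
  have WZ: "W \<subseteq> Z" using Z unfolding W_def by blast
  have "Metric_space (g ` W) (\<lambda>u v. d (p u) (p v))"
  proof
    fix u v w assume "u \<in> g ` W" "v \<in> g ` W" "w \<in> g ` W"
    then show "d (p u) (p w) \<le> d (p u) (p v) + d (p v) (p w)"
      using WZ p by (auto intro!: triangle)
  next
    fix u v assume "u \<in> g ` W" "v \<in> g ` W"
    then show "d (p u) (p v) = 0 \<longleftrightarrow> u = v"
      using WZ p by (auto simp: subset_iff)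
  qed (auto simp: commute)
  moreover have "dist_H (\<lambda>u v. d (p u) (p v)) (g ` hX ` X) (g ` hY ` Y) = dist_H d (hX ` X) (hY ` Y)"
    using p by (intro dist_H_cong) (auto simp: W_def)
  ultimately show ?thesis
    unfolding dist_GH_def using X Y p
    by (intro Inf_lower CollectI exI[of _ "g ` W"] exI[of _ "\<lambda>u v. d (p u) (p v)"]
          exI[of _ "g \<circ> hX"] exI[of _ "g \<circ> hY"])
       (auto simp: W_def image_image)
qed

lemma dist_oq_le:
  fixes V :: "'w::real_vector set"
  assumes V: "normed_space_on V N"
    and A: "subspace (ou_carrier A)" "ou_unit A \<in> ou_carrier A" "linear_isometric_embedding A V N hA"
    and B: "subspace (ou_carrier B)" "ou_unit B \<in> ou_carrier B" "linear_isometric_embedding B V N hB"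
  shows "dist_oq R A LA B LB \<le>
    max (dist_H (\<lambda>x y. N (x - y)) (hA ` lip_ball R A LA) (hB ` lip_ball R B LB))
        (ennreal (N (hA (R *\<^sub>R ou_unit A) - hB (R *\<^sub>R ou_unit B))))"
proof -
  define W where "W = {hA a + hB b | a b. a \<in> ou_carrier A \<and> b \<in> ou_carrier B}"
  note defs = linear_isometric_embedding_def linear_on_carrier_def
  have hlin: "x \<in> ou_carrier A \<Longrightarrow> y \<in> ou_carrier A \<Longrightarrow> hA (x + y) = hA x + hA y"
      "x \<in> ou_carrier A \<Longrightarrow> hA (c *\<^sub>R x) = c *\<^sub>R hA x"
      "u \<in> ou_carrier B \<Longrightarrow> v \<in> ou_carrier B \<Longrightarrow> hB (u + v) = hB u + hB v"
      "u \<in> ou_carrier B \<Longrightarrow> hB (c *\<^sub>R u) = c *\<^sub>R hB u" for x y u v c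
    using A(3) B(3) unfolding defs by blast+
  have hA0: "hA 0 = 0" and hB0: "hB 0 = 0"
    using A B unfolding defs by (metis scaleR_zero_left subspace_0)+
  have W: "subspace W"
  proof (rule subspaceI)
    show "0 \<in> W"
      unfolding W_def using hA0 hB0 subspace_0[OF A(1)] subspace_0[OF B(1)]
      by (auto intro!: exI[of _ 0])
  next
    fix x y assume "x \<in> W" "y \<in> W"
    then obtain a b a' b' where ab: "x = hA a + hB b" "y = hA a' + hB b'"
      "a \<in> ou_carrier A" "b \<in> ou_carrier B" "a' \<in> ou_carrier A" "b' \<in> ou_carrier B"
      unfolding W_def by blast
    then have "x + y = hA (a + a') + hB (b + b')"
      using A(3) B(3) unfolding defs by simp
    with ab show "x + y \<in> W"
      unfolding W_def using subspace_add[OF A(1)] subspace_add[OF B(1)] by blast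
  next
    fix c x assume "x \<in> W"
    then obtain a b where ab: "x = hA a + hB b" "a \<in> ou_carrier A" "b \<in> ou_carrier B"
      unfolding W_def by blast
    then have "c *\<^sub>R x = hA (c *\<^sub>R a) + hB (c *\<^sub>R b)"
      using A(3) B(3) unfolding defs by (simp add: scaleR_right_distrib)
    with ab show "c *\<^sub>R x \<in> W"
      unfolding W_def using subspace_scale[OF A(1)] subspace_scale[OF B(1)] by blast
  qed
  have AW: "hA a \<in> W" if "a \<in> ou_carrier A" for a
    unfolding W_def using that hB0 subspace_0[OF B(1)] by (intro CollectI exI[of _ a] exI[of _ 0]) auto
  have BW: "hB b \<in> W" if "b \<in> ou_carrier B" for b
    unfolding W_def using that hA0 subspace_0[OF A(1)] by (intro CollectI exI[of _ 0] exI[of _ b]) auto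
  have WV: "W \<subseteq> V"
  proof
    fix x assume "x \<in> W"
    then show "x \<in> V"
      using V A(3) B(3) unfolding W_def defs normed_space_on_def by (auto intro!: subspace_add)
  qed
  obtain Bs where Bs: "Bs \<subseteq> W" "independent Bs" "W \<subseteq> span Bs"
    using basis_exists[of W] by metis
  have "\<forall>x\<in>W. \<exists>q. hA (fst q) + hB (snd q) = x \<and> fst q \<in> ou_carrier A \<and> snd q \<in> ou_carrier B"
    unfolding W_def by auto
  then obtain s where s: "\<And>x. x \<in> W \<Longrightarrow> hA (fst (s x)) + hB (snd (s x)) = x \<and>
      fst (s x) \<in> ou_carrier A \<and> snd (s x) \<in> ou_carrier B"
    by metis
  obtain G :: "'w \<Rightarrow> 'a \<times> 'b" where G: "linear G" "\<forall>x\<in>Bs. G x = s x"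
    using linear_independent_extend[OF Bs(2)] by blast
  interpret G: linear G by (rule G)
  define \<phi> where "\<phi> q = hA (fst q) + hB (snd q)" for q
  let ?P = "\<lambda>x. fst (G x) \<in> ou_carrier A \<and> snd (G x) \<in> ou_carrier B \<and> \<phi> (G x) = x"
  have "subspace {x. ?P x}"
  proof (rule subspaceI)
    show "0 \<in> {x. ?P x}"
      using subspace_0[OF A(1)] subspace_0[OF B(1)] hA0 hB0 by (simp add: \<phi>_def G.zero)
  next
    fix x y assume xy: "x \<in> {x. ?P x}" "y \<in> {x. ?P x}"
    have "\<phi> (G (x + y)) = \<phi> (G x) + \<phi> (G y)"
    proof -
      have "fst (G x) \<in> ou_carrier A" "fst (G y) \<in> ou_carrier A"
        "snd (G x) \<in> ou_carrier B" "snd (G y) \<in> ou_carrier B"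
        using xy by blast+
      then show ?thesis by (simp add: \<phi>_def G.add hlin)
    qed
    moreover have "fst (G (x + y)) = fst (G x) + fst (G y)" "snd (G (x + y)) = snd (G x) + snd (G y)"
      by (simp_all add: G.add)
    ultimately show "x + y \<in> {x. ?P x}"
      using xy by (simp add: subspace_add[OF A(1)] subspace_add[OF B(1)])
  next
    fix c x assume x: "x \<in> {x. ?P x}"
    have "\<phi> (G (c *\<^sub>R x)) = c *\<^sub>R \<phi> (G x)"
    proof -
      have "fst (G x) \<in> ou_carrier A" "snd (G x) \<in> ou_carrier B"
        using x by blast+
      then show ?thesis by (simp add: \<phi>_def G.scale hlin scaleR_right_distrib)
    qed
    moreover have "fst (G (c *\<^sub>R x)) = c *\<^sub>R fst (G x)" "snd (G (c *\<^sub>R x)) = c *\<^sub>R snd (G x)"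
      by (simp_all add: G.scale)
    ultimately show "c *\<^sub>R x \<in> {x. ?P x}"
      using x by (simp add: subspace_scale[OF A(1)] subspace_scale[OF B(1)])
  qed
  moreover have "?P x" if "x \<in> Bs" for x
    using that G(2) s[of x] Bs(1) by (auto simp: \<phi>_def)
  ultimately have "span Bs \<subseteq> {x. ?P x}"
    by (intro span_minimal) auto
  then have \<phi>: "\<phi> (G x) = x" if "x \<in> W" for x
    using that Bs(3) by blast
  let ?N = "\<lambda>q. N (\<phi> q)"
  have GW: "?N (G x - G y) = N (x - y)" if "x \<in> W" "y \<in> W" for x y
    using \<phi>[of "x - y"] that subspace_diff[OF W] by (simp add: G.diff)
  have Nadd: "N (x + y) \<le> N x + N y" if "x \<in> W" "y \<in> W" for x y
    using V that[THEN subsetD[OF WV]] unfolding normed_space_on_def seminorm_on_def by simp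
  have N: "0 \<le> N x" "N (c *\<^sub>R x) = \<bar>c\<bar> * N x" "N x = 0 \<Longrightarrow> x = 0" if "x \<in> W" for x c
    using V that[THEN subsetD[OF WV]] unfolding normed_space_on_def seminorm_on_def by simp_all
  have \<phi>add: "\<phi> (G x + G y) = x + y" if "x \<in> W" "y \<in> W" for x y
    using \<phi>[of "x + y"] that subspace_add[OF W] by (simp add: G.add)
  have \<phi>sc: "\<phi> (c *\<^sub>R G x) = c *\<^sub>R x" if "x \<in> W" for x c
    using \<phi>[of "c *\<^sub>R x"] that subspace_scale[OF W] by (simp add: G.scale)
  have "normed_space_on (G ` W) ?N"
    unfolding normed_space_on_def seminorm_on_def
    using linear_subspace_image[OF G(1) W] by (auto simp: \<phi> \<phi>add \<phi>sc Nadd N(1,2) G.zero dest: N(3))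
  moreover have "linear_isometric_embedding A (G ` W) ?N (G \<circ> hA)"
    using A(3) AW unfolding defs by (auto simp: G.add G.scale \<phi>)
  moreover have "linear_isometric_embedding B (G ` W) ?N (G \<circ> hB)"
    using B(3) BW unfolding defs by (auto simp: G.add G.scale \<phi>)
  moreover have "dist_H (\<lambda>x y. ?N (x - y)) (G ` hA ` lip_ball R A LA) (G ` hB ` lip_ball R B LB) =
      dist_H (\<lambda>x y. N (x - y)) (hA ` lip_ball R A LA) (hB ` lip_ball R B LB)"
    using AW BW by (intro dist_H_cong) (auto simp: lip_ball_def GW)
  moreover have "?N (G (hA (R *\<^sub>R ou_unit A)) - G (hB (R *\<^sub>R ou_unit B))) =
      N (hA (R *\<^sub>R ou_unit A) - hB (R *\<^sub>R ou_unit B))"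
    using AW BW subspace_scale[OF A(1) A(2)] subspace_scale[OF B(1) B(2)] by (intro GW) auto
  ultimately show ?thesis
    unfolding dist_oq_def
    by (intro Inf_lower CollectI exI[of _ "G ` W"] exI[of _ ?N]
          exI[of _ "G \<circ> hA"] exI[of _ "G \<circ> hB"])
       (simp add: image_image)
qed


section \<open>Continuous fields\<close>

definition continuous_field_of_banach_spaces ::
    "('t::topological_space \<Rightarrow> 'v::real_vector set) \<Rightarrow> ('t \<Rightarrow> 'v \<Rightarrow> real) \<Rightarrow> ('t \<Rightarrow> 'v) set \<Rightarrow> bool"
  where
  "continuous_field_of_banach_spaces C N \<Gamma> \<longleftrightarrow>
     (\<forall>t. banach_space_on (C t) (N t)) \<and>
     (\<forall>f\<in>\<Gamma>. \<forall>t. f t \<in> C t) \<and>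
     (\<lambda>t. 0) \<in> \<Gamma> \<and>
     (\<forall>f\<in>\<Gamma>. \<forall>g\<in>\<Gamma>. (\<lambda>t. f t + g t) \<in> \<Gamma>) \<and>
     (\<forall>c. \<forall>f\<in>\<Gamma>. (\<lambda>t. c *\<^sub>R f t) \<in> \<Gamma>) \<and>
     (\<forall>t. \<forall>x\<in>C t. \<forall>\<epsilon>>0. \<exists>f\<in>\<Gamma>. N t (f t - x) < \<epsilon>) \<and>
     (\<forall>f\<in>\<Gamma>. continuous_on UNIV (\<lambda>t. N t (f t))) \<and>
     (\<forall>f. (\<forall>t. f t \<in> C t) \<and>
          (\<forall>t. \<forall>\<epsilon>>0. \<exists>g\<in>\<Gamma>. \<forall>\<^sub>F s in nhds t. N s (f s - g s) < \<epsilon>) \<longrightarrow> f \<in> \<Gamma>)"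

definition continuous_field_of_ou_spaces ::
    "('t::topological_space \<Rightarrow> 'v::real_vector ou_space) \<Rightarrow> ('t \<Rightarrow> 'v) set \<Rightarrow> bool" where
  "continuous_field_of_ou_spaces E \<Gamma> \<longleftrightarrow>
     (\<forall>t. complete_order_unit_space (E t)) \<and>
     continuous_field_of_banach_spaces (\<lambda>t. ou_carrier (E t)) (\<lambda>t. ou_norm (E t)) \<Gamma> \<and>
     (\<lambda>t. ou_unit (E t)) \<in> \<Gamma>"

definition lip_ext :: "'v ou_space \<Rightarrow> ('v \<Rightarrow> real) \<Rightarrow> 'v \<Rightarrow> ereal" where
  "lip_ext A L a = (if a \<in> ou_carrier A then ereal (L a) else \<infinity>)"

definition usc_at :: "('t::topological_space \<Rightarrow> ereal) \<Rightarrow> 't \<Rightarrow> bool" where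
  "usc_at \<phi> t \<longleftrightarrow> (\<forall>c>\<phi> t. \<forall>\<^sub>F s in nhds t. \<phi> s < c)"

definition lip_sections ::
    "('t::topological_space \<Rightarrow> 'v ou_space) \<Rightarrow> ('t \<Rightarrow> 'v \<Rightarrow> real) \<Rightarrow> ('t \<Rightarrow> 'v) set \<Rightarrow> 't \<Rightarrow> ('t \<Rightarrow> 'v) set"
  where
  "lip_sections A L \<Gamma> t = {f \<in> \<Gamma>. usc_at (\<lambda>s. lip_ext (A s) (L s) (f s)) t}"

text \<open>\<open>E t\<close> is the norm completion of \<open>A t\<close>.\<close>
definition continuous_field_of_cqms ::
    "('t::topological_space \<Rightarrow> 'v::real_vector ou_space) \<Rightarrow> ('t \<Rightarrow> 'v \<Rightarrow> real) \<Rightarrow>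
     ('t \<Rightarrow> 'v ou_space) \<Rightarrow> ('t \<Rightarrow> 'v) set \<Rightarrow> bool" where
  "continuous_field_of_cqms A L E \<Gamma> \<longleftrightarrow>
     (\<forall>t. compact_quantum_metric_space (A t) (L t)) \<and>
     (\<forall>t. ou_completion (A t) (E t)) \<and>
     continuous_field_of_ou_spaces E \<Gamma> \<and>
     (\<forall>t. \<forall>a\<in>ou_carrier (A t). \<forall>\<epsilon>>0. \<exists>f\<in>lip_sections A L \<Gamma> t.
        ou_norm (E t) (f t - a) < \<epsilon> \<and> lip_ext (A t) (L t) (f t) < ereal (L t a + \<epsilon>))"

end

theory Submission
  imports Defs
begin

text \<open>
  Write \<open>D t\<close> for the Lip-ball of radius \<open>R\<close> over \<open>t\<close>.  The order-unit distance dominates the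
  Gromov-Hausdorff distance of the \<open>D t\<close>, since a normed space is a metric space.  The two other
  implications rest on one fact about every field: a section whose value at \<open>t0\<close> lies in \<open>D t0\<close> stays
  close to \<open>D t\<close> for \<open>t\<close> near \<open>t0\<close> (\<open>section_stays_near_lip_ball\<close>).  So the only way in which \<open>D t\<close> may fail
  to converge to \<open>D t0\<close> is that it is too large, and the covering condition excludes exactly this.

  If the sections cover \<open>D t\<close>, then finitely many of them, together with the unit section, describe both
  \<open>D t\<close> and \<open>D t0\<close> up to a small error.  The norms of all linear combinations of finitely many sections
  vary continuously, uniformly in the coefficients, so the spans of their values at \<open>t\<close> and at \<open>t0\<close> are
  nearly isometric.  The norm on the product of the two fibres defined in the locale \<open>gluing\<close> extends
  both norms and brings the two values of each of these sections together; this bounds the order-unit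
  distance.

  If the Gromov-Hausdorff distances tend to zero, covering follows by counting.  By a theorem of Rieffel,
  \<open>D t0\<close> is totally bounded (\<open>lip_ball_separated_card_bounded\<close>), so it has a separated subset of largest
  size.  Sections through its points stay separated over nearby \<open>t\<close>, and a point of \<open>D t\<close> away from all of
  them would produce a separated subset of \<open>D t0\<close> with one more element.

  Total boundedness uses the states: they form a weak-* compact space, the elements of \<open>D t0\<close> are
  equi-Lipschitz functions on it for a metric of the same topology, and the supremum norm of these
  functions is the order-unit norm.  For the last point enough states are produced from maximal cones
  by Zorn's lemma.
\<close>

section \<open>Norms on a subspace\<close>

locale normed_carrier =
  fixes C :: "'a::real_vector set" and N :: "'a \<Rightarrow> real"
  assumes normed: "normed_space_on C N"
begin

lemma subspace_C: "subspace C"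
  using normed by (simp add: normed_space_on_def)

lemma mem [simp]:
  "0 \<in> C"
  "x \<in> C \<Longrightarrow> y \<in> C \<Longrightarrow> x + y \<in> C"
  "x \<in> C \<Longrightarrow> y \<in> C \<Longrightarrow> x - y \<in> C"
  "x \<in> C \<Longrightarrow> - x \<in> C"
  "x \<in> C \<Longrightarrow> c *\<^sub>R x \<in> C"
  using subspace_C
  by (auto intro: subspace_0 subspace_add subspace_diff subspace_neg subspace_scale)

lemma sum_mem: "(\<And>j. j \<in> J \<Longrightarrow> g j \<in> C) \<Longrightarrow> (\<Sum>j\<in>J. c j *\<^sub>R g j) \<in> C"
  by (intro subspace_sum[OF subspace_C]) auto

lemma nonneg: "x \<in> C \<Longrightarrow> 0 \<le> N x"
  and triangle: "x \<in> C \<Longrightarrow> y \<in> C \<Longrightarrow> N (x + y) \<le> N x + N y"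
  and scale: "x \<in> C \<Longrightarrow> N (c *\<^sub>R x) = \<bar>c\<bar> * N x"
  and definite: "x \<in> C \<Longrightarrow> N x = 0 \<Longrightarrow> x = 0"
  using normed by (simp_all add: normed_space_on_def seminorm_on_def)

lemma zero [simp]: "N 0 = 0"
  using scale[of 0 0] by simp

lemma minus: "x \<in> C \<Longrightarrow> N (- x) = N x"
  using scale[of x "-1"] by simp

lemma diff_commute: "x \<in> C \<Longrightarrow> y \<in> C \<Longrightarrow> N (x - y) = N (y - x)"
  using minus[of "x - y"] by simp

lemma diff_triangle: "x \<in> C \<Longrightarrow> y \<in> C \<Longrightarrow> z \<in> C \<Longrightarrow> N (x - z) \<le> N (x - y) + N (y - z)"
  using triangle[of "x - y" "y - z"] by simp

lemma abs_diff_le: "x \<in> C \<Longrightarrow> y \<in> C \<Longrightarrow> \<bar>N x - N y\<bar> \<le> N (x - y)"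
  using diff_triangle[of x y 0] diff_triangle[of y x 0] diff_commute[of x y] by simp

lemma sum_le:
  assumes "finite J" "\<And>j. j \<in> J \<Longrightarrow> g j \<in> C"
  shows "N (\<Sum>j\<in>J. c j *\<^sub>R g j) \<le> (\<Sum>j\<in>J. \<bar>c j\<bar> * N (g j))"
  using assms
proof (induction J rule: finite_induct)
  case (insert i J)
  have "N (c i *\<^sub>R g i + (\<Sum>j\<in>J. c j *\<^sub>R g j)) \<le> N (c i *\<^sub>R g i) + N (\<Sum>j\<in>J. c j *\<^sub>R g j)"
    using insert.prems by (intro triangle sum_mem) auto
  with insert scale[of "g i" "c i"] show ?case by simp
qed simp

lemma metric: "Metric_space C (\<lambda>x y. if x \<in> C \<and> y \<in> C then N (x - y) else 0)"
proof
  fix x y z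
  show "0 \<le> (if x \<in> C \<and> y \<in> C then N (x - y) else 0)"
    by (simp add: nonneg)
  show "(if x \<in> C \<and> y \<in> C then N (x - y) else 0) = (if y \<in> C \<and> x \<in> C then N (y - x) else 0)"
    using diff_commute[of x y] by simp
  assume "x \<in> C" "y \<in> C"
  then show "((if x \<in> C \<and> y \<in> C then N (x - y) else 0) = 0) = (x = y)"
    using definite[of "x - y"] by auto
  assume "z \<in> C"
  with \<open>x \<in> C\<close> \<open>y \<in> C\<close>
  show "(if x \<in> C \<and> z \<in> C then N (x - z) else 0)
      \<le> (if x \<in> C \<and> y \<in> C then N (x - y) else 0) + (if y \<in> C \<and> z \<in> C then N (y - z) else 0)"
    using diff_triangle[of x y z] by simp
qed

end

section \<open>States of an order-unit space\<close>

locale order_unit_carrier =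
  fixes A :: "'v::real_vector ou_space"
  assumes ou: "order_unit_space A"
begin

abbreviation "C \<equiv> ou_carrier A"
abbreviation "e \<equiv> ou_unit A"

lemma subspace_C: "subspace C"
  using ou by (simp add: order_unit_space_def ordered_vector_space_on_def)

lemma mem [simp]:
  "0 \<in> C"
  "x \<in> C \<Longrightarrow> y \<in> C \<Longrightarrow> x + y \<in> C"
  "x \<in> C \<Longrightarrow> y \<in> C \<Longrightarrow> x - y \<in> C"
  "x \<in> C \<Longrightarrow> - x \<in> C"
  "x \<in> C \<Longrightarrow> c *\<^sub>R x \<in> C"
  "e \<in> C"
  using subspace_C ou
  by (auto intro: subspace_0 subspace_add subspace_diff subspace_neg subspace_scale
      simp: order_unit_space_def)

lemma order_axioms:
  "\<forall>x\<in>C. \<forall>y\<in>C. ou_le A x y \<and> ou_le A y x \<longrightarrow> x = y"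
  "\<forall>x\<in>C. \<forall>y\<in>C. \<forall>z\<in>C. ou_le A x y \<and> ou_le A y z \<longrightarrow> ou_le A x z"
  "\<forall>x\<in>C. ou_le A x x"
  "\<forall>x\<in>C. \<forall>y\<in>C. \<forall>z\<in>C. ou_le A x y \<longrightarrow> ou_le A (x + z) (y + z)"
  "\<forall>x\<in>C. \<forall>y\<in>C. \<forall>c\<ge>0. ou_le A x y \<longrightarrow> ou_le A (c *\<^sub>R x) (c *\<^sub>R y)"
  "ou_le A 0 e" "e \<noteq> 0" "\<forall>a\<in>C. \<exists>r. ou_le A a (r *\<^sub>R e)"
  using ou unfolding order_unit_space_def ordered_vector_space_on_def by - (elim conjE, assumption)+

lemma antisym: "x \<in> C \<Longrightarrow> y \<in> C \<Longrightarrow> ou_le A x y \<Longrightarrow> ou_le A y x \<Longrightarrow> x = y"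
  using order_axioms(1) by blast

lemma trans: "x \<in> C \<Longrightarrow> y \<in> C \<Longrightarrow> z \<in> C \<Longrightarrow> ou_le A x y \<Longrightarrow> ou_le A y z \<Longrightarrow> ou_le A x z"
  using order_axioms(2) by blast

lemma refl: "x \<in> C \<Longrightarrow> ou_le A x x"
  using order_axioms(3) by blast

lemma add_right:
  "x \<in> C \<Longrightarrow> y \<in> C \<Longrightarrow> z \<in> C \<Longrightarrow> ou_le A x y \<Longrightarrow> ou_le A (x + z) (y + z)"
  using order_axioms(4) by blast

lemma scale:
  "x \<in> C \<Longrightarrow> y \<in> C \<Longrightarrow> 0 \<le> c \<Longrightarrow> ou_le A x y \<Longrightarrow> ou_le A (c *\<^sub>R x) (c *\<^sub>R y)"
  using order_axioms(5) by blast

lemma unit_pos: "ou_le A 0 e" and unit_nz: "e \<noteq> 0"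
  using order_axioms(6,7) .

lemma bounded: "x \<in> C \<Longrightarrow> \<exists>r. ou_le A x (r *\<^sub>R e)"
  using order_axioms(8) by blast

lemma le_iff_diff:
  assumes "x \<in> C" "y \<in> C"
  shows "ou_le A x y \<longleftrightarrow> ou_le A 0 (y - x)"
  using add_right[of x y "-x"] add_right[of 0 "y - x" x] assms by auto

lemma pos_add: "x \<in> C \<Longrightarrow> y \<in> C \<Longrightarrow> ou_le A 0 x \<Longrightarrow> ou_le A 0 y \<Longrightarrow> ou_le A 0 (x + y)"
  using add_right[of 0 x y] trans[of 0 y "x + y"] by simp

lemma pos_scale: "x \<in> C \<Longrightarrow> 0 \<le> c \<Longrightarrow> ou_le A 0 x \<Longrightarrow> ou_le A 0 (c *\<^sub>R x)"
  using scale[of 0 x c] by simp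

lemma neg_unit_not_pos: "\<not> ou_le A 0 (- e)"
  using add_right[of 0 "- e" e] antisym[of 0 e] unit_pos unit_nz by auto

lemma le_neg: "x \<in> C \<Longrightarrow> y \<in> C \<Longrightarrow> ou_le A x y \<Longrightarrow> ou_le A (- y) (- x)"
  using le_iff_diff[of x y] le_iff_diff[of "-y" "-x"] by simp

text \<open>
  Such a cone is the positive cone of a coarser preorder on the same space for which \<open>e\<close> is
  still not negative.  Coarsening as far as possible replaces the Hahn-Banach theorem: if every
  element is comparable with \<open>0\<close>, the preorder is read off from one positive functional.
\<close>
definition proper_cone :: "'v set \<Rightarrow> bool" where
  "proper_cone K \<longleftrightarrow> K \<subseteq> C \<and> {x \<in> C. ou_le A 0 x} \<subseteq> K \<and> - e \<notin> K \<and>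
     (\<forall>x\<in>K. \<forall>y\<in>K. x + y \<in> K) \<and> (\<forall>c\<ge>0. \<forall>x\<in>K. c *\<^sub>R x \<in> K)"

lemma cone_ray:
  assumes K: "proper_cone K" and x: "x \<in> C" and no: "\<And>k t. k \<in> K \<Longrightarrow> t > 0 \<Longrightarrow> - e \<noteq> k + t *\<^sub>R x"
  shows "proper_cone {k + t *\<^sub>R x | k t. k \<in> K \<and> 0 \<le> t}" (is "proper_cone ?M")
proof -
  have K': "K \<subseteq> C" "{x \<in> C. ou_le A 0 x} \<subseteq> K" "- e \<notin> K"
    "\<And>x y. x \<in> K \<Longrightarrow> y \<in> K \<Longrightarrow> x + y \<in> K" "\<And>c x. 0 \<le> c \<Longrightarrow> x \<in> K \<Longrightarrow> c *\<^sub>R x \<in> K"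
    using K unfolding proper_cone_def by blast+
  show ?thesis
    unfolding proper_cone_def
  proof (intro conjI ballI allI impI)
    show "?M \<subseteq> C" using K'(1) x by auto
    have "K \<subseteq> ?M" by (force intro: exI[of _ 0])
    then show "{x \<in> C. ou_le A 0 x} \<subseteq> ?M" using K'(2) by blast
    show "- e \<notin> ?M"
    proof
      assume "- e \<in> ?M"
      then obtain k t where kt: "- e = k + t *\<^sub>R x" "k \<in> K" "0 \<le> t" by blast
      then show False using no[of k t] K'(3) by (cases "t = 0") auto
    qed
  next
    fix y z assume "y \<in> ?M" "z \<in> ?M"
    then obtain k t l s where "y = k + t *\<^sub>R x" "k \<in> K" "0 \<le> t" "z = l + s *\<^sub>R x" "l \<in> K" "0 \<le> s"
      by blast
    then show "y + z \<in> ?M"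
      using K'(4) by (intro CollectI exI[of _ "k + l"] exI[of _ "t + s"]) (auto simp: algebra_simps)
  next
    fix c :: real and y assume "0 \<le> c" "y \<in> ?M"
    then obtain k t where "y = k + t *\<^sub>R x" "k \<in> K" "0 \<le> t" by blast
    then show "c *\<^sub>R y \<in> ?M"
      using K'(5)[OF \<open>0 \<le> c\<close>] \<open>0 \<le> c\<close>
      by (intro CollectI exI[of _ "c *\<^sub>R k"] exI[of _ "c * t"]) (auto simp: algebra_simps)
  qed
qed

text \<open>
  A maximal cone is total: if \<open>x \<notin> K\<close>, then adding the ray through \<open>x\<close> must put \<open>- e\<close>
  into the cone, so \<open>- e = k + t x\<close> with \<open>t > 0\<close>, and then \<open>- x = (k + e) / t\<close> lies in \<open>K\<close>.
\<close>
lemma cone_extends_to_total: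
  assumes K0: "proper_cone K0"
  obtains K where "proper_cone K" "K0 \<subseteq> K" "\<And>x. x \<in> C \<Longrightarrow> x \<in> K \<or> - x \<in> K"
proof -
  let ?S = "{K. proper_cone K \<and> K0 \<subseteq> K}"
  have "\<Union>\<K> \<in> ?S" if ne: "\<K> \<noteq> {}" and ch: "subset.chain ?S \<K>" for \<K>
  proof -
    have el: "proper_cone K" "K0 \<subseteq> K" if "K \<in> \<K>" for K
      using ch that unfolding subset.chain_def by auto
    have lin: "K \<subseteq> K' \<or> K' \<subseteq> K" if "K \<in> \<K>" "K' \<in> \<K>" for K K'
      using subset_chain_def[of ?S \<K>] ch that by blast
    have "x + y \<in> \<Union>\<K>" if xy: "x \<in> \<Union>\<K>" "y \<in> \<Union>\<K>" for x y
    proof -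
      obtain K K' where "K \<in> \<K>" "x \<in> K" "K' \<in> \<K>" "y \<in> K'" using xy by blast
      then obtain M where "M \<in> \<K>" "x \<in> M" "y \<in> M" using lin[of K K'] by blast
      then show ?thesis using el(1)[of M] unfolding proper_cone_def by blast
    qed
    moreover have "c *\<^sub>R x \<in> \<Union>\<K>" if "0 \<le> c" "x \<in> \<Union>\<K>" for c x
      using that el(1) unfolding proper_cone_def by blast
    moreover have "\<Union>\<K> \<subseteq> C" "- e \<notin> \<Union>\<K>"
      using el(1) unfolding proper_cone_def by blast+
    moreover obtain K1 where "K1 \<in> \<K>" using ne by blast
    moreover from this have "{x \<in> C. ou_le A 0 x} \<subseteq> \<Union>\<K>" "K0 \<subseteq> \<Union>\<K>"
      using el unfolding proper_cone_def by blast+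
    ultimately show ?thesis
      unfolding proper_cone_def by simp
  qed
  then have "\<exists>K\<in>?S. \<forall>M\<in>?S. K \<subseteq> M \<longrightarrow> M = K"
    using K0 by (intro subset_Zorn_nonempty) auto
  then obtain K where K: "proper_cone K" "K0 \<subseteq> K"
    and max: "\<And>M. proper_cone M \<Longrightarrow> K0 \<subseteq> M \<Longrightarrow> K \<subseteq> M \<Longrightarrow> M = K"
    by (smt (verit) mem_Collect_eq)
  have cl: "K \<subseteq> C" "{x \<in> C. ou_le A 0 x} \<subseteq> K" "- e \<notin> K"
    "\<And>x y. x \<in> K \<Longrightarrow> y \<in> K \<Longrightarrow> x + y \<in> K" "\<And>c x. 0 \<le> c \<Longrightarrow> x \<in> K \<Longrightarrow> c *\<^sub>R x \<in> K"
    using K(1) unfolding proper_cone_def by blast+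
  have "- x \<in> K" if x: "x \<in> C" and xK: "x \<notin> K" for x
  proof -
    let ?M = "{k + t *\<^sub>R x | k t. k \<in> K \<and> 0 \<le> t}"
    have "0 \<in> K" using cl(2) refl[of 0] by auto
    then have "x \<in> ?M" by (intro CollectI exI[of _ 0] exI[of _ 1]) auto
    moreover have "K \<subseteq> ?M" by (force intro: exI[of _ 0])
    ultimately have "\<not> proper_cone ?M" using max[of ?M] K(2) xK by blast
    then obtain k t where kt: "k \<in> K" "t > 0" "- e = k + t *\<^sub>R x"
      using cone_ray[OF K(1) x] by blast
    have "k + e = k - (k + t *\<^sub>R x)" by (simp flip: kt(3))
    also have "\<dots> = t *\<^sub>R (- x)" by simp
    finally have "(1 / t) *\<^sub>R (k + e) = - x" using kt(2) by simp
    moreover have "e \<in> K" using cl(2) unit_pos by auto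
    ultimately show ?thesis using cl(4)[of k e] cl(5)[of "1 / t" "k + e"] kt by simp
  qed
  with K that show thesis by blast
qed

text \<open>
  The functional is the Dedekind cut \<open>x \<mapsto> inf {r. r e - x \<in> K}\<close>.  Totality of \<open>K\<close> says that
  every \<open>r\<close> below the cut satisfies \<open>x - r e \<in> K\<close>, which turns the obvious subadditivity into
  additivity.
\<close>
lemma total_cone_functional:
  assumes K: "proper_cone K" and total: "\<And>x. x \<in> C \<Longrightarrow> x \<in> K \<or> - x \<in> K"
  obtains \<mu> where "\<And>x y. x \<in> C \<Longrightarrow> y \<in> C \<Longrightarrow> \<mu> (x + y) = \<mu> x + \<mu> y"
    "\<And>c x. x \<in> C \<Longrightarrow> \<mu> (c *\<^sub>R x) = c * \<mu> x" "\<mu> e = 1" "\<And>x. x \<in> K \<Longrightarrow> 0 \<le> \<mu> x"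
proof -
  define \<mu> where "\<mu> x = Inf {r::real. r *\<^sub>R e - x \<in> K}" for x
  have cl: "K \<subseteq> C" "\<And>x. x \<in> C \<Longrightarrow> ou_le A 0 x \<Longrightarrow> x \<in> K" "- e \<notin> K"
    "\<And>x y. x \<in> K \<Longrightarrow> y \<in> K \<Longrightarrow> x + y \<in> K" "\<And>c x. 0 \<le> c \<Longrightarrow> x \<in> K \<Longrightarrow> c *\<^sub>R x \<in> K"
    using K unfolding proper_cone_def by blast+
  have eK: "e \<in> K" "0 \<in> K" using cl(2) unit_pos refl[of 0] by auto
  have unit_mult: "0 \<le> r" if "r *\<^sub>R e \<in> K" for r
    using cl(5)[of "1 / - r" "r *\<^sub>R e"] that cl(3) by (cases "r < 0") auto
  have cmp: "r \<le> s" if "x - r *\<^sub>R e \<in> K" "s *\<^sub>R e - x \<in> K" for r s x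
    using cl(4)[OF that] unit_mult[of "s - r"] by (simp add: algebra_simps)
  have ne: "\<exists>r. r *\<^sub>R e - x \<in> K" if "x \<in> C" for x
    using bounded[OF that] le_iff_diff[of x] that cl(2) by (metis mem(3,5,6))
  have ne': "\<exists>r. x - r *\<^sub>R e \<in> K" if x: "x \<in> C" for x
  proof -
    obtain r where "r *\<^sub>R e - (- x) \<in> K" using ne[of "- x"] mem(4)[OF x] by blast
    then show ?thesis by (intro exI[of _ "- r"]) (simp add: add.commute)
  qed
  have bdd: "bdd_below {r. r *\<^sub>R e - x \<in> K}" if "x \<in> C" for x
    using ne'[OF that] cmp unfolding bdd_below_def by blast
  have le: "\<mu> x \<le> r" if "x \<in> C" "r *\<^sub>R e - x \<in> K" for x r
    unfolding \<mu>_def using that bdd by (intro cInf_lower) auto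
  have ge: "r \<le> \<mu> x" if "x \<in> C" "x - r *\<^sub>R e \<in> K" for x r
    unfolding \<mu>_def using that ne cmp by (intro cInf_greatest) auto
  have up: "r *\<^sub>R e - x \<in> K" if x: "x \<in> C" and r: "\<mu> x < r" for x r
  proof -
    obtain s where s: "s *\<^sub>R e - x \<in> K" "s < r"
      using cInf_lessD[of "{r. r *\<^sub>R e - x \<in> K}" r] ne[OF x] r unfolding \<mu>_def by blast
    have "s *\<^sub>R e - x + (r - s) *\<^sub>R e \<in> K" using s eK cl(4,5) by simp
    then show ?thesis by (simp add: algebra_simps)
  qed
  have dn: "x - r *\<^sub>R e \<in> K" if x: "x \<in> C" and r: "r < \<mu> x" for x r
    using total[of "r *\<^sub>R e - x"] le[of x r] x r by force
  show thesis
  proof (rule that[of \<mu>])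
    show add: "\<mu> (x + y) = \<mu> x + \<mu> y" if xy: "x \<in> C" "y \<in> C" for x y
    proof (rule order_antisym)
      have "\<mu> (x + y) \<le> r + s" if "\<mu> x < r" "\<mu> y < s" for r s
      proof -
        have "(r *\<^sub>R e - x) + (s *\<^sub>R e - y) \<in> K"
          using up that xy by (intro cl(4)) auto
        then show ?thesis
          using xy by (intro le) (auto simp: algebra_simps)
      qed
      from this[of "\<mu> x + d / 2" "\<mu> y + d / 2" for d]
      have "\<mu> (x + y) \<le> \<mu> x + \<mu> y + d" if "0 < d" for d
        using that by fastforce
      then show "\<mu> (x + y) \<le> \<mu> x + \<mu> y"
        by (rule field_le_epsilon)
      have "r + s \<le> \<mu> (x + y)" if "r < \<mu> x" "s < \<mu> y" for r s
      proof -
        have "(x - r *\<^sub>R e) + (y - s *\<^sub>R e) \<in> K"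
          using dn that xy by (intro cl(4)) auto
        then show ?thesis
          using xy by (intro ge) (auto simp: algebra_simps)
      qed
      from this[of "\<mu> x - d / 2" "\<mu> y - d / 2" for d]
      have "\<mu> x + \<mu> y \<le> \<mu> (x + y) + d" if "0 < d" for d
        using that by fastforce
      then show "\<mu> x + \<mu> y \<le> \<mu> (x + y)"
        by (rule field_le_epsilon)
    qed
    have \<mu>0: "\<mu> 0 = 0" using add[of 0 0] by simp
    have scale_pos: "c * \<mu> x \<le> \<mu> (c *\<^sub>R x)" if x: "x \<in> C" and c: "c > 0" for x c
    proof (rule field_le_epsilon)
      fix d :: real assume "0 < d"
      then have "x - (\<mu> x - d / c) *\<^sub>R e \<in> K" using dn[of x "\<mu> x - d / c"] x c by simp
      then have "c *\<^sub>R (x - (\<mu> x - d / c) *\<^sub>R e) \<in> K" using cl(5) c by simp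
      moreover have "c *\<^sub>R (x - (\<mu> x - d / c) *\<^sub>R e) = c *\<^sub>R x - (c * \<mu> x - d) *\<^sub>R e"
        using c by (simp add: algebra_simps)
      ultimately show "c * \<mu> x \<le> \<mu> (c *\<^sub>R x) + d"
        using ge[of "c *\<^sub>R x" "c * \<mu> x - d"] x by simp
    qed
    have scale_pos': "\<mu> (c *\<^sub>R x) = c * \<mu> x" if x: "x \<in> C" and c: "c > 0" for x c
      using scale_pos[OF x c] scale_pos[of "c *\<^sub>R x" "1 / c"] x c by (simp add: field_simps)
    have neg: "\<mu> (- x) = - \<mu> x" if "x \<in> C" for x
      using add[of x "- x"] that \<mu>0 by simp
    show "\<mu> (c *\<^sub>R x) = c * \<mu> x" if x: "x \<in> C" for c x
    proof (cases c "0::real" rule: linorder_cases)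
      case less
      then show ?thesis using scale_pos'[of x "- c"] neg[of "c *\<^sub>R x"] x by simp
    qed (use scale_pos' \<mu>0 x in auto)
    show "\<mu> e = 1" using le[of e 1] ge[of e 1] eK by simp
    show "0 \<le> \<mu> x" if "x \<in> K" for x using ge[of x 0] that cl(1) by auto
  qed
qed

lemma norm_set_lower:
  assumes "ou_le A (- r *\<^sub>R e) a" "ou_le A a (r *\<^sub>R e)" "a \<in> C"
  shows "0 \<le> r"
proof (rule ccontr)
  assume r: "\<not> 0 \<le> r"
  have "ou_le A (- r *\<^sub>R e) (r *\<^sub>R e)" using trans[of _ a] assms by simp
  then have "ou_le A 0 (r *\<^sub>R e + r *\<^sub>R e)"
    using le_iff_diff[of "- r *\<^sub>R e" "r *\<^sub>R e"] by simp
  then have "ou_le A 0 ((1 / (- 2 * r)) *\<^sub>R (r *\<^sub>R e + r *\<^sub>R e))"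
    using r by (intro pos_scale) auto
  moreover have "(1 / (- 2 * r)) *\<^sub>R (r *\<^sub>R e + r *\<^sub>R e) = (- 1) *\<^sub>R e"
    using r by (simp only: scaleR_scaleR flip: scaleR_add_left) simp
  ultimately show False using neg_unit_not_pos by simp
qed

lemma ou_norm_le:
  assumes "a \<in> C" "ou_le A (- r *\<^sub>R e) a" "ou_le A a (r *\<^sub>R e)"
  shows "ou_norm A a \<le> r"
  unfolding ou_norm_def using assms norm_set_lower[OF _ _ assms(1)]
  by (intro cInf_lower) (auto simp: bdd_below_def)

lemma norm_set_nonempty:
  assumes a: "a \<in> C"
  shows "\<exists>r. ou_le A (- r *\<^sub>R e) a \<and> ou_le A a (r *\<^sub>R e)"
proof -
  obtain r s where r: "ou_le A a (r *\<^sub>R e)" "ou_le A (- a) (s *\<^sub>R e)"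
    using bounded[of a] bounded[of "- a"] a by auto
  have mono: "ou_le A (p *\<^sub>R e) (q *\<^sub>R e)" if "p \<le> q" for p q
    using that le_iff_diff[of "p *\<^sub>R e" "q *\<^sub>R e"] pos_scale[of e "q - p"] unit_pos
    by (simp add: algebra_simps)
  have "ou_le A (- s *\<^sub>R e) a" using le_neg[OF _ _ r(2)] a by simp
  then have "ou_le A (- max r s *\<^sub>R e) a"
    using mono[of "- max r s" "- s"] trans[of "- max r s *\<^sub>R e" "- s *\<^sub>R e" a] a by simp
  moreover have "ou_le A a (max r s *\<^sub>R e)"
    using mono[of r "max r s"] trans[of a "r *\<^sub>R e" "max r s *\<^sub>R e"] r(1) a by simp
  ultimately show ?thesis by blast
qed

lemma ou_norm_unit_le: "ou_norm A e \<le> 1"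
proof (rule ou_norm_le)
  have "e - (- 1) *\<^sub>R e = 2 *\<^sub>R e" by (simp add: scaleR_2)
  then show "ou_le A (- 1 *\<^sub>R e) e"
    using le_iff_diff[of "- 1 *\<^sub>R e" e] pos_scale[of e 2] unit_pos by simp
  show "ou_le A e (1 *\<^sub>R e)" by (simp add: refl)
qed simp

lemma unital_positive_is_state:
  assumes ext: "\<mu> \<in> extensional C" and lin: "linear_on_carrier C \<mu>" and unit: "\<mu> e = 1"
    and pos: "\<And>x. x \<in> C \<Longrightarrow> ou_le A 0 x \<Longrightarrow> 0 \<le> \<mu> x"
  shows "\<mu> \<in> states A"
proof -
  have add: "\<mu> (x + y) = \<mu> x + \<mu> y" and sc: "\<mu> (c *\<^sub>R x) = c * \<mu> x" if "x \<in> C" "y \<in> C" for x y c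
    using lin that unfolding linear_on_carrier_def by auto
  have mono: "\<mu> x \<le> \<mu> y" if "x \<in> C" "y \<in> C" "ou_le A x y" for x y
  proof -
    have "0 \<le> \<mu> (y - x)" using pos[of "y - x"] le_iff_diff[of x y] that by simp
    moreover have "\<mu> (y - x + x) = \<mu> (y - x) + \<mu> x" using that by (intro add) auto
    ultimately show ?thesis by simp
  qed
  have "\<bar>\<mu> a\<bar> \<le> ou_norm A a" if a: "a \<in> C" for a
    unfolding ou_norm_def
  proof (rule cInf_greatest)
    fix r assume "r \<in> {r. ou_le A (- r *\<^sub>R e) a \<and> ou_le A a (r *\<^sub>R e)}"
    then show "\<bar>\<mu> a\<bar> \<le> r"
      using mono[of "- r *\<^sub>R e" a] mono[of a "r *\<^sub>R e"] a sc[of e e r] sc[of e e "- r"] unit by auto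
  qed (use norm_set_nonempty[OF a] in blast)
  then have "dual_norm A \<mu> \<le> 1"
    unfolding dual_norm_def by (intro SUP_least) (auto intro: order_trans simp: ennreal_le_1)
  moreover have "ennreal \<bar>\<mu> e\<bar> \<le> dual_norm A \<mu>"
    unfolding dual_norm_def using ou_norm_unit_le by (intro SUP_upper) auto
  ultimately show ?thesis
    unfolding states_def using ext lin unit by auto
qed

text \<open>
  If \<open>a \<le> s e\<close> fails, the ray through \<open>a - s e\<close> can be added to the positive cone without
  reaching \<open>- e\<close>; a functional that is nonnegative on the enlarged cone is at least \<open>s\<close> at \<open>a\<close>.
\<close>
lemma state_above:
  assumes a: "a \<in> C" and not_le: "\<not> ou_le A a (s *\<^sub>R e)"
  shows "\<exists>\<mu>\<in>states A. s \<le> \<mu> a"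
proof -
  let ?P = "{x \<in> C. ou_le A 0 x}"
  have P: "proper_cone ?P"
    unfolding proper_cone_def using neg_unit_not_pos pos_add pos_scale by auto
  have "- e \<noteq> k + t *\<^sub>R (a - s *\<^sub>R e)" if k: "k \<in> ?P" and t: "t > 0" for k t
  proof
    assume eq: "- e = k + t *\<^sub>R (a - s *\<^sub>R e)"
    have "k + e = k - (k + t *\<^sub>R (a - s *\<^sub>R e))" by (simp flip: eq)
    also have "\<dots> = t *\<^sub>R (s *\<^sub>R e - a)" by (simp add: algebra_simps)
    finally have "(1 / t) *\<^sub>R (k + e) = s *\<^sub>R e - a" using t by simp
    moreover have "ou_le A 0 ((1 / t) *\<^sub>R (k + e))"
      using k t unit_pos by (intro pos_scale pos_add) auto
    ultimately show False using not_le le_iff_diff[of a "s *\<^sub>R e"] a by simp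
  qed
  then have "proper_cone {k + t *\<^sub>R (a - s *\<^sub>R e) | k t. k \<in> ?P \<and> 0 \<le> t}" (is "proper_cone ?K0")
    using a by (intro cone_ray P) auto
  then obtain K where K: "proper_cone K" "?K0 \<subseteq> K" "\<And>x. x \<in> C \<Longrightarrow> x \<in> K \<or> - x \<in> K"
    using cone_extends_to_total by blast
  obtain \<mu> where \<mu>: "\<And>x y. x \<in> C \<Longrightarrow> y \<in> C \<Longrightarrow> \<mu> (x + y) = \<mu> x + \<mu> y"
    "\<And>c x. x \<in> C \<Longrightarrow> \<mu> (c *\<^sub>R x) = c * \<mu> x" "\<mu> e = 1" "\<And>x. x \<in> K \<Longrightarrow> 0 \<le> \<mu> x"
    using total_cone_functional[OF K(1,3)] by blast
  have "restrict \<mu> C \<in> states A"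
  proof (rule unital_positive_is_state)
    show "linear_on_carrier C (restrict \<mu> C)"
      unfolding linear_on_carrier_def using \<mu>(1,2) by auto
    show "0 \<le> restrict \<mu> C x" if "x \<in> C" "ou_le A 0 x" for x
      using that \<mu>(4)[of x] K(1) unfolding proper_cone_def by auto
  qed (use \<mu>(3) in auto)
  moreover have "a - s *\<^sub>R e \<in> ?K0"
    using refl[of 0] by (intro CollectI exI[of _ 0] exI[of _ 1]) auto
  then have "0 \<le> \<mu> (a - s *\<^sub>R e)" using K(2) \<mu>(4) by blast
  then have "s \<le> \<mu> a" using \<mu>(1)[of "a - s *\<^sub>R e" "s *\<^sub>R e"] \<mu>(2)[of e s] \<mu>(3) a by simp
  ultimately show ?thesis using a by (intro bexI[of _ "restrict \<mu> C"]) auto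
qed

text \<open>
  States compute the order-unit norm.  This is how estimates on states, which are all that a
  Lip-norm provides, become norm estimates.
\<close>
lemma ou_norm_le_if_states_le:
  assumes a: "a \<in> C" and le: "\<And>\<mu>. \<mu> \<in> states A \<Longrightarrow> \<bar>\<mu> a\<bar> \<le> r"
  shows "ou_norm A a \<le> r"
proof (rule field_le_epsilon)
  fix d :: real assume d: "0 < d"
  have up: "ou_le A a ((r + d) *\<^sub>R e)"
  proof (rule ccontr)
    assume "\<not> ?thesis"
    then obtain \<mu> where "\<mu> \<in> states A" "r + d \<le> \<mu> a" using state_above[OF a] by blast
    then show False using le[of \<mu>] d by auto
  qed
  have "ou_le A (- a) ((r + d) *\<^sub>R e)"
  proof (rule ccontr)
    assume "\<not> ?thesis"
    then obtain \<mu> where \<mu>: "\<mu> \<in> states A" "r + d \<le> \<mu> (- a)" using state_above[of "- a"] a by auto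
    have "linear_on_carrier C \<mu>" using \<mu>(1) by (simp add: states_def)
    then have "\<mu> ((- 1) *\<^sub>R a) = (- 1) *\<^sub>R \<mu> a"
      using a unfolding linear_on_carrier_def by blast
    then show False using le[of \<mu>] d \<mu> by auto
  qed
  then have "ou_le A (- ((r + d) *\<^sub>R e)) (- (- a))" using a by (intro le_neg) auto
  then have "ou_le A (- (r + d) *\<^sub>R e) a" by (simp only: minus_minus scaleR_minus_left)
  with up show "ou_norm A a \<le> r + d" using ou_norm_le a by blast
qed

end

section \<open>Total boundedness of Lip-balls\<close>

context order_unit_carrier
begin

lemma state_linear:
  assumes "\<mu> \<in> states A"
  shows "x \<in> C \<Longrightarrow> y \<in> C \<Longrightarrow> \<mu> (x + y) = \<mu> x + \<mu> y"
    and "x \<in> C \<Longrightarrow> \<mu> (c *\<^sub>R x) = c * \<mu> x"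
    and "x \<in> C \<Longrightarrow> y \<in> C \<Longrightarrow> \<mu> (x - y) = \<mu> x - \<mu> y"
proof -
  have lin: "linear_on_carrier C \<mu>" using assms by (simp add: states_def)
  show add: "\<mu> (x + y) = \<mu> x + \<mu> y" if "x \<in> C" "y \<in> C" for x y
    using lin that by (simp add: linear_on_carrier_def)
  show "\<mu> (c *\<^sub>R x) = c * \<mu> x" if "x \<in> C"
    using lin that by (simp add: linear_on_carrier_def)
  show "\<mu> (x - y) = \<mu> x - \<mu> y" if "x \<in> C" "y \<in> C"
    using add[of "x - y" y] that by simp
qed

lemma dual_norm_le_1_iff:
  "dual_norm A \<mu> \<le> 1 \<longleftrightarrow> (\<forall>a\<in>C. ou_norm A a \<le> 1 \<longrightarrow> \<bar>\<mu> a\<bar> \<le> 1)"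
  unfolding dual_norm_def by (auto simp: SUP_le_iff)

lemma states_eq:
  "states A = {\<mu> \<in> extensional C. linear_on_carrier C \<mu> \<and> \<mu> e = 1 \<and>
     (\<forall>a\<in>C. ou_norm A a \<le> 1 \<longrightarrow> \<bar>\<mu> a\<bar> \<le> 1)}"
proof -
  have "ennreal \<bar>\<mu> e\<bar> \<le> dual_norm A \<mu>" for \<mu>
    unfolding dual_norm_def using ou_norm_unit_le by (intro SUP_upper) auto
  then have "dual_norm A \<mu> = 1 \<longleftrightarrow> dual_norm A \<mu> \<le> 1" if "\<mu> e = 1" for \<mu>
    using that by (metis abs_one ennreal_1 order_antisym order_refl)
  then show ?thesis
    unfolding states_def dual_norm_le_1_iff[symmetric] by blast
qed

text \<open>
  The bound \<open>t + 1\<close> in place of \<open>t\<close> avoids a case distinction: \<open>a / (t + 1)\<close> makes sense for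
  \<open>t = 0\<close> too and has norm at most \<open>1\<close>.
\<close>
lemma state_abs_le:
  assumes \<mu>: "\<mu> \<in> states A" and a: "a \<in> C" and t: "ou_le A (- t *\<^sub>R e) a" "ou_le A a (t *\<^sub>R e)"
  shows "\<bar>\<mu> a\<bar> \<le> t + 1"
proof -
  let ?c = "1 / (t + 1)"
  have t0: "0 \<le> t" by (rule norm_set_lower[OF t a])
  have "ou_norm A (?c *\<^sub>R a) \<le> ?c * t"
    using scale[OF _ _ _ t(1), of ?c] scale[OF _ _ _ t(2), of ?c] a t0
    by (intro ou_norm_le) auto
  also have "\<dots> \<le> 1" using t0 by (simp add: field_simps)
  finally have "\<bar>\<mu> (?c *\<^sub>R a)\<bar> \<le> 1"
    using \<mu> a unfolding states_eq by simp
  then show ?thesis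
    using t0 unfolding state_linear(2)[OF \<mu> a] by (simp add: abs_mult field_simps)
qed

text \<open>
  Banach-Alaoglu: the states form a closed subset of a product of compact intervals, because each of
  their defining conditions involves finitely many coordinates.
\<close>
lemma states_weak_star_compact:
  "compactin (product_topology (\<lambda>_. euclideanreal) C) (states A)"
proof -
  let ?T = "product_topology (\<lambda>_. euclideanreal) C"
  have "\<forall>a\<in>C. \<exists>t. ou_le A (- t *\<^sub>R e) a \<and> ou_le A a (t *\<^sub>R e)"
    using norm_set_nonempty by blast
  then obtain t where t: "\<And>a. a \<in> C \<Longrightarrow> ou_le A (- t a *\<^sub>R e) a \<and> ou_le A a (t a *\<^sub>R e)"
    by metis
  have "compactin ?T (PiE C (\<lambda>a. {- (t a + 1)..t a + 1}))"
    by (simp add: compactin_PiE)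
  moreover have "states A \<subseteq> PiE C (\<lambda>a. {- (t a + 1)..t a + 1})"
  proof
    fix \<mu> assume \<mu>: "\<mu> \<in> states A"
    then show "\<mu> \<in> PiE C (\<lambda>a. {- (t a + 1)..t a + 1})"
      using state_abs_le[OF \<mu>] t unfolding PiE_def by (force simp: states_def abs_le_iff)
  qed
  moreover have "closedin ?T (states A)"
  proof -
    have pre: "closedin ?T {\<mu> \<in> extensional C. g \<mu> \<in> S}"
      if "continuous_map ?T euclideanreal g" "closed S" for g S
      using closedin_continuous_map_preimage[OF that(1), of S] that(2) by (simp add: PiE_def)
    have proj: "continuous_map ?T euclideanreal (\<lambda>\<mu>. \<mu> x)" if "x \<in> C" for x
      using that by (rule continuous_map_product_projection)
    have "states A = {\<mu> \<in> extensional C. \<mu> e \<in> {1}} \<inter>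
      (\<Inter>x\<in>C. \<Inter>y\<in>C. {\<mu> \<in> extensional C. \<mu> (x + y) - (\<mu> x + \<mu> y) \<in> {0}}) \<inter>
      (\<Inter>c. \<Inter>x\<in>C. {\<mu> \<in> extensional C. \<mu> (c *\<^sub>R x) - c * \<mu> x \<in> {0}}) \<inter>
      (\<Inter>a\<in>{a \<in> C. ou_norm A a \<le> 1}. {\<mu> \<in> extensional C. \<mu> a \<in> {-1..1}})"
      unfolding states_eq linear_on_carrier_def by (auto simp: abs_le_iff)
    also have "closedin ?T \<dots>"
    proof (intro closedin_Int closedin_INT pre)
      show "C \<noteq> {}" "C \<noteq> {}" "C \<noteq> {}" "{a \<in> C. ou_norm A a \<le> 1} \<noteq> {}"
        using mem(6) ou_norm_unit_le by blast+
      fix x y and c :: real assume "x \<in> C" "y \<in> C"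
      then show "continuous_map ?T euclideanreal (\<lambda>\<mu>. \<mu> (x + y) - (\<mu> x + \<mu> y))"
        by (intro continuous_intros proj) auto
    next
      fix x and c :: real assume "x \<in> C"
      then show "continuous_map ?T euclideanreal (\<lambda>\<mu>. \<mu> (c *\<^sub>R x) - c * \<mu> x)"
        by (intro continuous_intros proj) auto
    qed (auto intro: proj)
    finally show ?thesis .
  qed
  ultimately show ?thesis
    by (rule closed_compactin)
qed

lemma lip_dist_triangle: "lip_dist A L \<mu> \<rho> \<le> lip_dist A L \<mu> \<nu> + lip_dist A L \<nu> \<rho>"
  unfolding lip_dist_def
proof (rule SUP_least)
  fix a assume a: "a \<in> {a \<in> C. L a \<le> 1}"
  have "ennreal \<bar>\<mu> a - \<rho> a\<bar> \<le> ennreal (\<bar>\<mu> a - \<nu> a\<bar> + \<bar>\<nu> a - \<rho> a\<bar>)"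
    by (intro ennreal_leI) auto
  also have "\<dots> = ennreal \<bar>\<mu> a - \<nu> a\<bar> + ennreal \<bar>\<nu> a - \<rho> a\<bar>"
    by simp
  also have "\<dots> \<le> (SUP a\<in>{a \<in> C. L a \<le> 1}. ennreal \<bar>\<mu> a - \<nu> a\<bar>) +
      (SUP a\<in>{a \<in> C. L a \<le> 1}. ennreal \<bar>\<nu> a - \<rho> a\<bar>)"
    using a by (intro add_mono SUP_upper)
  finally show "ennreal \<bar>\<mu> a - \<rho> a\<bar> \<le> \<dots>" .
qed

lemma openin_lip_dist_ball: "openin (lip_topology A L) {\<nu> \<in> states A. lip_dist A L \<mu> \<nu> < \<epsilon>}"
  unfolding openin_lip_topology
proof (intro conjI ballI)
  fix \<nu> assume "\<nu> \<in> {\<nu> \<in> states A. lip_dist A L \<mu> \<nu> < \<epsilon>}"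
  then have \<nu>: "\<nu> \<in> states A" "lip_dist A L \<mu> \<nu> < \<epsilon>" by auto
  have "lip_dist A L \<mu> \<rho> < \<epsilon>" if "lip_dist A L \<nu> \<rho> < \<epsilon> - lip_dist A L \<mu> \<nu>" for \<rho>
  proof -
    have "lip_dist A L \<mu> \<nu> + lip_dist A L \<nu> \<rho> < \<epsilon>"
      using that less_diff_eq_ennreal[of \<epsilon> "lip_dist A L \<mu> \<nu>" "lip_dist A L \<nu> \<rho>"] \<nu>(2)
        order_less_le_trans[OF \<nu>(2) top_greatest] by (simp add: add.commute)
    then show ?thesis
      using lip_dist_triangle le_less_trans by blast
  qed
  then show "\<exists>\<delta>>0. \<forall>\<rho>\<in>states A. lip_dist A L \<nu> \<rho> < \<delta> \<longrightarrow> \<rho> \<in> {\<nu> \<in> states A. lip_dist A L \<mu> \<nu> < \<epsilon>}"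
    using \<nu>(2) by (intro exI[of _ "\<epsilon> - lip_dist A L \<mu> \<nu>"]) (auto simp: diff_gr0_ennreal)
qed auto

text \<open>
  Balls for \<open>lip_dist\<close> are open for the weak-* topology by the assumption on Lip-norms, so finitely
  many of them cover the compact space of states.
\<close>
lemma finite_lip_dist_net:
  assumes "lip_norm A L" and "0 < \<epsilon>"
  shows "\<exists>M. finite M \<and> M \<subseteq> states A \<and> (\<forall>\<nu>\<in>states A. \<exists>\<mu>\<in>M. lip_dist A L \<mu> \<nu> < \<epsilon>)"
proof -
  let ?B = "\<lambda>\<mu>. {\<nu> \<in> states A. lip_dist A L \<mu> \<nu> < \<epsilon>}"
  have eq: "lip_topology A L = weak_star_topology A"
    using assms(1) by (simp add: lip_norm_def)
  have "compactin (weak_star_topology A) (states A)"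
    using states_weak_star_compact by (simp add: weak_star_topology_def compactin_subtopology)
  moreover have "openin (weak_star_topology A) B" if "B \<in> ?B ` states A" for B
    using that openin_lip_dist_ball[of L _ \<epsilon>] unfolding eq by blast
  moreover have "states A \<subseteq> \<Union> (?B ` states A)"
  proof
    fix \<mu> assume "\<mu> \<in> states A"
    moreover have "lip_dist A L \<mu> \<mu> \<le> 0" unfolding lip_dist_def by (intro SUP_least) simp
    ultimately have "\<mu> \<in> ?B \<mu>" using assms(2) by (auto intro: le_less_trans)
    with \<open>\<mu> \<in> states A\<close> show "\<mu> \<in> \<Union> (?B ` states A)" by blast
  qed
  ultimately obtain \<F> where \<F>: "finite \<F>" "\<F> \<subseteq> ?B ` states A" "states A \<subseteq> \<Union>\<F>"
    unfolding compactin_def by meson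
  then obtain M where M: "M \<subseteq> states A" "finite M" "\<F> = ?B ` M"
    using finite_subset_image[OF \<F>(1,2)] by blast
  have "\<exists>\<mu>\<in>M. lip_dist A L \<mu> \<nu> < \<epsilon>" if "\<nu> \<in> states A" for \<nu>
    using that \<F>(3) unfolding M(3) by auto
  with M show ?thesis by blast
qed

text \<open>
  Rieffel's total boundedness theorem, in the form of a bound on the size of separated sets.
  The elements of the Lip-ball are \<open>1\<close>-Lipschitz functions on the states, so an element is known up
  to a multiple of \<open>d\<close> once its values on a finite \<open>d\<close>-net of states are known up to \<open>d\<close>; rounding
  these bounded values to multiples of \<open>d\<close> leaves finitely many possibilities \<open>Z\<close>.
\<close>
lemma lip_ball_separated_card_bounded:
  assumes L: "lip_norm A L" and s: "0 < s"
  shows "\<exists>K. \<forall>F. finite F \<longrightarrow> F \<subseteq> lip_ball r A L \<longrightarrow>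
    pairwise (\<lambda>x y. s < ou_norm A (x - y)) F \<longrightarrow> card F \<le> K"
proof -
  \<comment> \<open>Comparing two elements at a state costs two steps to the net and one rounding.\<close>
  define d where "d = s / 3"
  have d: "0 < d" using s by (simp add: d_def)
  obtain M where M: "finite M" "M \<subseteq> states A"
    and net: "\<And>\<nu>. \<nu> \<in> states A \<Longrightarrow> \<exists>\<mu>\<in>M. lip_dist A L \<mu> \<nu> < ennreal d"
    using finite_lip_dist_net[OF L, of "ennreal d"] d by auto
  define B where "B = (r + 2) / d"
  define Z where "Z = PiE M (\<lambda>_. {\<lfloor>- B\<rfloor>..\<lfloor>B\<rfloor>})"
  define \<Phi> where "\<Phi> a = restrict (\<lambda>\<mu>. \<lfloor>\<mu> a / d\<rfloor>) M" for a
  have finZ: "finite Z" unfolding Z_def using M(1) by (intro finite_PiE) auto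
  have \<Phi>Z: "\<Phi> a \<in> Z" if a: "a \<in> lip_ball r A L" for a
  proof -
    have aC: "a \<in> C" and ar: "ou_norm A a < r + 1" using a by (auto simp: lip_ball_def)
    obtain t where t: "ou_le A (- t *\<^sub>R e) a" "ou_le A a (t *\<^sub>R e)" "t < r + 1"
      using cInf_lessD[OF _ ar[unfolded ou_norm_def]] norm_set_nonempty[OF aC] by auto
    have "\<lfloor>\<mu> a / d\<rfloor> \<in> {\<lfloor>- B\<rfloor>..\<lfloor>B\<rfloor>}" if "\<mu> \<in> M" for \<mu>
    proof -
      have "\<bar>\<mu> a\<bar> \<le> r + 2" using state_abs_le[OF _ aC t(1,2), of \<mu>] that M(2) t(3) by auto
      then have "\<bar>\<mu> a / d\<bar> \<le> B" using d by (simp add: B_def divide_right_mono)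
      then have "- B \<le> \<mu> a / d" "\<mu> a / d \<le> B" by linarith+
      then show ?thesis unfolding atLeastAtMost_iff by (intro conjI floor_mono)
    qed
    then show ?thesis unfolding Z_def \<Phi>_def by simp
  qed
  have close: "ou_norm A (a - b) \<le> s"
    if a: "a \<in> lip_ball r A L" and b: "b \<in> lip_ball r A L" and eq: "\<Phi> a = \<Phi> b" for a b
  proof (rule ou_norm_le_if_states_le)
    have aC: "a \<in> C" "L a \<le> 1" and bC: "b \<in> C" "L b \<le> 1" using a b by (auto simp: lip_ball_def)
    then show "a - b \<in> C" by simp
    fix \<nu> assume \<nu>: "\<nu> \<in> states A"
    obtain \<mu> where \<mu>: "\<mu> \<in> M" "lip_dist A L \<mu> \<nu> < ennreal d" using net[OF \<nu>] by blast
    have *: "\<bar>\<mu> x - \<nu> x\<bar> < d" if "x \<in> C" "L x \<le> 1" for x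
    proof -
      have "ennreal \<bar>\<mu> x - \<nu> x\<bar> \<le> lip_dist A L \<mu> \<nu>"
        unfolding lip_dist_def using that by (intro SUP_upper) auto
      also note \<mu>(2)
      finally show ?thesis by (simp add: ennreal_less_iff)
    qed
    have "\<lfloor>\<mu> a / d\<rfloor> = \<lfloor>\<mu> b / d\<rfloor>"
      using fun_cong[OF eq, of \<mu>] \<mu>(1) by (simp add: \<Phi>_def)
    then have "\<bar>\<mu> a / d - \<mu> b / d\<bar> < 1" by linarith
    then have "\<bar>\<mu> a - \<mu> b\<bar> < d" 
      using d by (simp add: pos_divide_less_eq flip: diff_divide_distrib)
    with *[OF aC] *[OF bC] have "\<bar>\<nu> a - \<nu> b\<bar> \<le> s" unfolding d_def by linarith
    then show "\<bar>\<nu> (a - b)\<bar> \<le> s" using state_linear(3)[OF \<nu>] aC bC by simp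
  qed
  have "card F \<le> card Z" if "F \<subseteq> lip_ball r A L" "pairwise (\<lambda>x y. s < ou_norm A (x - y)) F" for F
  proof (rule card_inj_on_le[of \<Phi>])
    show "inj_on \<Phi> F" using that close unfolding inj_on_def pairwise_def by (metis not_less subsetD)
  qed (use that \<Phi>Z finZ in auto)
  then show ?thesis by blast
qed

end

section \<open>Separated sets and the Gromov-Hausdorff distance\<close>

lemma dist_H_lessD:
  assumes "dist_H d X Y < \<epsilon>" and "x \<in> X"
  shows "\<exists>y\<in>Y. ennreal (d x y) < \<epsilon>"
proof -
  have "(INF y\<in>Y. ennreal (d x y)) \<le> (SUP x\<in>X. INF y\<in>Y. ennreal (d x y))"
    using assms(2) by (rule SUP_upper)
  also have "\<dots> < \<epsilon>"
    using assms(1) by (simp add: dist_H_def)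
  finally show ?thesis by (simp add: INF_less_iff)
qed

lemma dist_H_leI:
  assumes "\<And>x. x \<in> X \<Longrightarrow> \<exists>y\<in>Y. d x y \<le> \<epsilon>" and "\<And>y. y \<in> Y \<Longrightarrow> \<exists>x\<in>X. d x y \<le> \<epsilon>"
  shows "dist_H d X Y \<le> ennreal \<epsilon>"
  unfolding dist_H_def
proof (intro max.boundedI SUP_least)
  fix x assume "x \<in> X"
  then obtain y where "y \<in> Y" "d x y \<le> \<epsilon>" using assms(1) by blast
  then show "(INF y\<in>Y. ennreal (d x y)) \<le> ennreal \<epsilon>" by (intro INF_lower2 ennreal_leI)
next
  fix y assume "y \<in> Y"
  then obtain x where "x \<in> X" "d x y \<le> \<epsilon>" using assms(2) by blast
  then show "(INF x\<in>X. ennreal (d x y)) \<le> ennreal \<epsilon>" by (intro INF_lower2 ennreal_leI)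
qed

text \<open>
  Moving each point by less than \<open>\<eta>\<close> inside a common metric space changes distances by less than
  \<open>2 * \<eta>\<close>; since \<open>s \<ge> 0\<close>, distinct points stay distinct and the cardinality survives.
\<close>
lemma separated_set_transfer:
  assumes gh: "dist_GH X dX Y dY < ennreal \<eta>"
    and F: "F \<subseteq> X" "pairwise (\<lambda>x y. s + 2 * \<eta> < dX x y) F" and s: "0 \<le> s"
  shows "\<exists>F'. F' \<subseteq> Y \<and> card F' = card F \<and> pairwise (\<lambda>x y. s < dY x y) F'"
proof -
  obtain Z :: "('a + 'b) set" and d hX hY where Z: "Metric_space Z d"
    "hX ` X \<subseteq> Z" "hY ` Y \<subseteq> Z" "\<forall>x\<in>X. \<forall>x'\<in>X. d (hX x) (hX x') = dX x x'"
    "\<forall>y\<in>Y. \<forall>y'\<in>Y. d (hY y) (hY y') = dY y y'" and less: "dist_H d (hX ` X) (hY ` Y) < ennreal \<eta>"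
    using gh unfolding dist_GH_def Inf_less_iff by blast
  interpret Metric_space Z d by fact
  have "\<exists>y\<in>Y. d (hX x) (hY y) < \<eta>" if "x \<in> X" for x
    using dist_H_lessD[OF less, of "hX x"] that by (auto simp: ennreal_less_iff)
  then obtain g where g: "\<And>x. x \<in> X \<Longrightarrow> g x \<in> Y \<and> d (hX x) (hY (g x)) < \<eta>"
    by metis
  have far: "s < dY (g x) (g x')" if x: "x \<in> F" "x' \<in> F" "x \<noteq> x'" for x x'
  proof -
    have X: "x \<in> X" "x' \<in> X" using x F(1) by auto
    then have mem: "hX x \<in> Z" "hX x' \<in> Z" "hY (g x) \<in> Z" "hY (g x') \<in> Z"
      using Z(2,3) g by blast+
    have "s + 2 * \<eta> < d (hX x) (hX x')"
      using pairwiseD[OF F(2) x] Z(4) X by simp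
    also have "\<dots> \<le> d (hX x) (hY (g x)) + d (hY (g x)) (hY (g x')) + d (hX x') (hY (g x'))"
      using triangle[of "hX x" "hY (g x)" "hX x'"] triangle[of "hY (g x)" "hY (g x')" "hX x'"] mem
        commute[of "hX x'" "hY (g x')"] by auto
    finally have "s < d (hY (g x)) (hY (g x'))"
      using g[of x] g[of x'] X by auto
    then show ?thesis using Z(5) g X by simp
  qed
  have "inj_on g F"
  proof (rule inj_onI, rule ccontr)
    fix x x' assume x: "x \<in> F" "x' \<in> F" "g x = g x'" "x \<noteq> x'"
    have "g x' \<in> Y" using x F(1) g[of x'] by auto
    moreover from this have "hY (g x') \<in> Z" using Z(3) by auto
    ultimately have "dY (g x') (g x') = 0" using Z(5) by (metis mdist_zero)
    then show False using far[of x x'] x s by simp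
  qed
  then have "card (g ` F) = card F" by (rule card_image)
  moreover have "g ` F \<subseteq> Y" using g F(1) by blast
  moreover have "pairwise (\<lambda>x y. s < dY x y) (g ` F)"
    using far unfolding pairwise_def by auto
  ultimately show ?thesis by blast
qed

text \<open>
  A normed space that contains both order-unit spaces is in particular a metric space that contains
  both Lip-balls.  Only the cut-off of the metric outside the carrier needs attention.
\<close>
lemma dist_GH_le_dist_oq:
  assumes A: "subspace (ou_carrier A)" and B: "subspace (ou_carrier B)"
  shows "dist_GH (lip_ball R A LA) (\<lambda>x y. ou_norm A (x - y))
      (lip_ball R B LB) (\<lambda>x y. ou_norm B (x - y)) \<le> dist_oq R A LA B LB"
  unfolding dist_oq_def
proof (rule Inf_greatest, clarify)
  fix V :: "('a \<times> 'b) set" and N hA hB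
  assume V: "normed_space_on V N"
    and hA: "linear_isometric_embedding A V N hA" and hB: "linear_isometric_embedding B V N hB"
  interpret normed_carrier V N by unfold_locales (rule V)
  let ?d = "\<lambda>x y. if x \<in> V \<and> y \<in> V then N (x - y) else 0"
  let ?X = "lip_ball R A LA" and ?Y = "lip_ball R B LB"
  have iso: "N (h x - h y) = ou_norm S (x - y)"
    if "linear_isometric_embedding S V N h" "subspace (ou_carrier S)"
      "x \<in> ou_carrier S" "y \<in> ou_carrier S"
    for S :: "'c::real_vector ou_space" and h x y
  proof -
    have "x - y \<in> ou_carrier S" using that by (auto intro: subspace_diff)
    moreover have "h (x - y + y) = h (x - y) + h y"
      using that calculation unfolding linear_isometric_embedding_def linear_on_carrier_def by blast
    ultimately show ?thesis
      using that unfolding linear_isometric_embedding_def by simp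
  qed
  have XC: "?X \<subseteq> ou_carrier A" and YC: "?Y \<subseteq> ou_carrier B" by (auto simp: lip_ball_def)
  have mem: "hA ` ?X \<subseteq> V" "hB ` ?Y \<subseteq> V"
    using hA hB XC YC unfolding linear_isometric_embedding_def by blast+
  have "dist_GH ?X (\<lambda>x y. ou_norm A (x - y)) ?Y (\<lambda>x y. ou_norm B (x - y))
      \<le> dist_H ?d (hA ` ?X) (hB ` ?Y)"
  proof (rule dist_GH_le[OF metric mem])
    show "\<forall>x\<in>?X. \<forall>x'\<in>?X. ?d (hA x) (hA x') = ou_norm A (x - x')"
      using subsetD[OF mem(1)] iso[OF hA A] subsetD[OF XC] by simp
    show "\<forall>x\<in>?Y. \<forall>x'\<in>?Y. ?d (hB x) (hB x') = ou_norm B (x - x')"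
      using subsetD[OF mem(2)] iso[OF hB B] subsetD[OF YC] by simp
  qed
  also have "dist_H ?d (hA ` ?X) (hB ` ?Y) = dist_H (\<lambda>x y. N (x - y)) (hA ` ?X) (hB ` ?Y)"
    using dist_H_cong[of "hA ` ?X" "hB ` ?Y" ?d id "\<lambda>x y. N (x - y)"]
      subsetD[OF mem(1)] subsetD[OF mem(2)] by (simp del: image_eqI)
  also have "\<dots> \<le> max \<dots> (ennreal (N (hA (R *\<^sub>R ou_unit A) - hB (R *\<^sub>R ou_unit B))))"
    by simp
  finally show "dist_GH ?X (\<lambda>x y. ou_norm A (x - y)) ?Y (\<lambda>x y. ou_norm B (x - y))
      \<le> max (dist_H (\<lambda>x y. N (x - y)) (hA ` ?X) (hB ` ?Y))
          (ennreal (N (hA (R *\<^sub>R ou_unit A) - hB (R *\<^sub>R ou_unit B))))" .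
qed

section \<open>Gluing two normed spaces along nearly isometric families\<close>

text \<open>
  Two families \<open>u\<close> and \<open>v\<close> that span nearly isometric subspaces can be made nearly equal in a common
  normed space.  The norm on \<open>C \<times> D\<close> is the largest one that extends \<open>p\<close> and \<open>q\<close> and gives every
  \<open>(u j, - v j)\<close> norm at most \<open>\<epsilon>\<close>: it is the least cost of writing a vector as a part in \<open>C\<close>, a part
  in \<open>D\<close> and a combination of these differences, which are charged \<open>\<epsilon>\<close> each.
\<close>
locale gluing = X: normed_carrier C p + Y: normed_carrier D q
  for C :: "'a::real_vector set" and p and D :: "'b::real_vector set" and q +
  fixes J :: "'i set" and u :: "'i \<Rightarrow> 'a" and v :: "'i \<Rightarrow> 'b" and \<epsilon> :: real
  assumes J: "finite J" and \<epsilon>: "0 < \<epsilon>"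
    and u: "\<And>j. j \<in> J \<Longrightarrow> u j \<in> C" and v: "\<And>j. j \<in> J \<Longrightarrow> v j \<in> D"
    and almost_iso: "\<And>c. \<bar>p (\<Sum>j\<in>J. c j *\<^sub>R u j) - q (\<Sum>j\<in>J. c j *\<^sub>R v j)\<bar> \<le> \<epsilon> * (\<Sum>j\<in>J. \<bar>c j\<bar>)"
begin

definition cost :: "'a \<times> 'b \<Rightarrow> ('i \<Rightarrow> real) \<Rightarrow> real" where
  "cost z c = p (fst z - (\<Sum>j\<in>J. c j *\<^sub>R u j)) + q (snd z + (\<Sum>j\<in>J. c j *\<^sub>R v j)) +
     \<epsilon> * (\<Sum>j\<in>J. \<bar>c j\<bar>)"

definition glued_norm :: "'a \<times> 'b \<Rightarrow> real" where
  "glued_norm z = (INF c. cost z c)"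

lemma sum_u: "(\<Sum>j\<in>J. c j *\<^sub>R u j) \<in> C" and sum_v: "(\<Sum>j\<in>J. c j *\<^sub>R v j) \<in> D"
  using u v by (simp_all add: X.sum_mem Y.sum_mem)

lemma cost_nonneg: "z \<in> C \<times> D \<Longrightarrow> 0 \<le> cost z c"
  unfolding cost_def using sum_u sum_v \<epsilon>
  by (intro add_nonneg_nonneg X.nonneg Y.nonneg mult_nonneg_nonneg sum_nonneg) auto

lemma bdd: "z \<in> C \<times> D \<Longrightarrow> bdd_below (range (cost z))"
  using cost_nonneg unfolding bdd_below_def by blast

lemma glued_norm_le: "z \<in> C \<times> D \<Longrightarrow> glued_norm z \<le> cost z c"
  unfolding glued_norm_def by (intro cINF_lower bdd) auto

lemma glued_norm_ge: "(\<And>c. m \<le> cost z c) \<Longrightarrow> m \<le> glued_norm z"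
  unfolding glued_norm_def by (intro cINF_greatest) auto

lemma glued_norm_approx:
  assumes "glued_norm z < m"
  obtains c where "cost z c < m"
  using assms cInf_lessD[of "range (cost z)" m] unfolding glued_norm_def by auto

text \<open>
  The embedding of \<open>C\<close> is isometric because a combination with coefficients \<open>c\<close> that moves mass from
  \<open>C\<close> to \<open>D\<close> saves at most \<open>\<epsilon> * (\<Sum>j\<in>J. \<bar>c j\<bar>)\<close> by the hypothesis, which is what it is charged.
\<close>
lemma glued_norm_left: "x \<in> C \<Longrightarrow> glued_norm (x, 0) = p x"
proof (rule antisym)
  assume x: "x \<in> C"
  show "glued_norm (x, 0) \<le> p x"
    using glued_norm_le[of "(x, 0)" "\<lambda>_. 0"] x by (simp add: cost_def)
  show "p x \<le> glued_norm (x, 0)"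
  proof (rule glued_norm_ge)
    fix c
    have "p x \<le> p (x - (\<Sum>j\<in>J. c j *\<^sub>R u j)) + p (\<Sum>j\<in>J. c j *\<^sub>R u j)"
      using X.diff_triangle[of x "\<Sum>j\<in>J. c j *\<^sub>R u j" 0] x sum_u by simp
    then show "p x \<le> cost (x, 0) c" using almost_iso[of c] by (simp add: cost_def abs_le_iff)
  qed
qed

lemma glued_norm_right: "y \<in> D \<Longrightarrow> glued_norm (0, y) = q y"
proof (rule antisym)
  assume y: "y \<in> D"
  show "glued_norm (0, y) \<le> q y"
    using glued_norm_le[of "(0, y)" "\<lambda>_. 0"] y by (simp add: cost_def)
  show "q y \<le> glued_norm (0, y)"
  proof (rule glued_norm_ge)
    fix c
    have "q y \<le> q (y + (\<Sum>j\<in>J. c j *\<^sub>R v j)) + q (\<Sum>j\<in>J. c j *\<^sub>R v j)"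
      using Y.diff_triangle[of y "- (\<Sum>j\<in>J. c j *\<^sub>R v j)" 0] y sum_v Y.minus by simp
    then show "q y \<le> cost (0, y) c"
      using almost_iso[of c] X.minus sum_u by (simp add: cost_def abs_le_iff)
  qed
qed

lemma glued_norm_pair: "j \<in> J \<Longrightarrow> glued_norm (u j, - v j) \<le> \<epsilon>"
proof -
  assume j: "j \<in> J"
  let ?c = "\<lambda>i. if i = j then 1 else 0 :: real"
  have "(\<Sum>i\<in>J. ?c i *\<^sub>R u i) = (\<Sum>i\<in>J. if j = i then u i else 0)"
    "(\<Sum>i\<in>J. ?c i *\<^sub>R v i) = (\<Sum>i\<in>J. if j = i then v i else 0)"
    "(\<Sum>i\<in>J. \<bar>?c i\<bar>) = (\<Sum>i\<in>J. if j = i then 1 else 0)"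
    by (intro sum.cong; auto)+
  then have "cost (u j, - v j) ?c = \<epsilon>"
    using j J by (simp add: cost_def)
  then show ?thesis
    using glued_norm_le[of "(u j, - v j)" ?c] j u v by simp
qed

lemma glued_norm_add:
  assumes z: "z \<in> C \<times> D" and w: "w \<in> C \<times> D"
  shows "glued_norm (z + w) \<le> glued_norm z + glued_norm w"
proof (rule field_le_epsilon)
  fix d :: real assume d: "0 < d"
  obtain a where a: "cost z a < glued_norm z + d / 2"
    using glued_norm_approx[of z "glued_norm z + d / 2"] d by auto
  obtain b where b: "cost w b < glued_norm w + d / 2"
    using glued_norm_approx[of w "glued_norm w + d / 2"] d by auto
  let ?U = "\<lambda>c. \<Sum>j\<in>J. c j *\<^sub>R u j" and ?V = "\<lambda>c. \<Sum>j\<in>J. c j *\<^sub>R v j"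
  let ?c = "\<lambda>j. a j + b j"
  have U: "fst (z + w) - ?U ?c = (fst z - ?U a) + (fst w - ?U b)"
    and V: "snd (z + w) + ?V ?c = (snd z + ?V a) + (snd w + ?V b)"
    by (simp_all add: scaleR_add_left sum.distrib)
  have "p (fst (z + w) - ?U ?c) \<le> p (fst z - ?U a) + p (fst w - ?U b)"
    unfolding U using z w sum_u by (intro X.triangle) auto
  moreover have "q (snd (z + w) + ?V ?c) \<le> q (snd z + ?V a) + q (snd w + ?V b)"
    unfolding V using z w sum_v by (intro Y.triangle) auto
  moreover have "\<epsilon> * (\<Sum>j\<in>J. \<bar>?c j\<bar>) \<le> \<epsilon> * ((\<Sum>j\<in>J. \<bar>a j\<bar>) + (\<Sum>j\<in>J. \<bar>b j\<bar>))"
    unfolding sum.distrib[symmetric] using \<epsilon> by (intro mult_left_mono sum_mono abs_triangle_ineq) auto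
  ultimately have "cost (z + w) ?c \<le> cost z a + cost w b"
    unfolding cost_def by (simp add: distrib_left)
  moreover have "z + w \<in> C \<times> D" using z w by (auto simp: mem_Times_iff)
  ultimately show "glued_norm (z + w) \<le> glued_norm z + glued_norm w + d"
    using glued_norm_le[of "z + w" ?c] a b by simp
qed

lemma cost_scale:
  assumes z: "z \<in> C \<times> D"
  shows "cost (s *\<^sub>R z) (\<lambda>j. s * c j) = \<bar>s\<bar> * cost z c"
proof -
  let ?U = "\<Sum>j\<in>J. c j *\<^sub>R u j" and ?V = "\<Sum>j\<in>J. c j *\<^sub>R v j"
  have "(\<Sum>j\<in>J. (s * c j) *\<^sub>R u j) = s *\<^sub>R ?U" "(\<Sum>j\<in>J. (s * c j) *\<^sub>R v j) = s *\<^sub>R ?V"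
    by (simp_all add: scaleR_sum_right)
  then have "cost (s *\<^sub>R z) (\<lambda>j. s * c j) =
      p (s *\<^sub>R (fst z - ?U)) + q (s *\<^sub>R (snd z + ?V)) + \<epsilon> * (\<bar>s\<bar> * (\<Sum>j\<in>J. \<bar>c j\<bar>))"
    by (simp add: cost_def abs_mult sum_distrib_left scaleR_right_diff_distrib scaleR_add_right)
  also have "\<dots> = \<bar>s\<bar> * cost z c"
    using z sum_u sum_v by (subst X.scale Y.scale; force?)+ (simp add: cost_def algebra_simps)
  finally show ?thesis .
qed

lemma glued_norm_scale:
  assumes z: "z \<in> C \<times> D"
  shows "glued_norm (s *\<^sub>R z) = \<bar>s\<bar> * glued_norm z"
proof -
  have le: "glued_norm (s *\<^sub>R z) \<le> \<bar>s\<bar> * glued_norm z" if s: "s \<noteq> 0" and z: "z \<in> C \<times> D" for s z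
  proof -
    have "s *\<^sub>R z \<in> C \<times> D" using z by (auto simp: mem_Times_iff)
    then have "glued_norm (s *\<^sub>R z) / \<bar>s\<bar> \<le> cost z c" for c
      using glued_norm_le[of "s *\<^sub>R z" "\<lambda>j. s * c j"] cost_scale[OF z, of s c] s
      by (simp add: field_simps)
    then have "glued_norm (s *\<^sub>R z) / \<bar>s\<bar> \<le> glued_norm z" by (rule glued_norm_ge)
    then show ?thesis using s by (simp add: field_simps)
  qed
  show ?thesis
  proof (cases "s = 0")
    case True
    then show ?thesis using glued_norm_left[of 0] by (simp add: zero_prod_def)
  next
    case False
    have "s *\<^sub>R z \<in> C \<times> D" using z by (auto simp: mem_Times_iff)
    then have "glued_norm z \<le> \<bar>1 / s\<bar> * glued_norm (s *\<^sub>R z)"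
      using le[of "1 / s" "s *\<^sub>R z"] False by simp
    then show ?thesis using le[OF False z] False by (simp add: field_simps)
  qed
qed

text \<open>
  Here \<open>\<epsilon> > 0\<close> is essential: a decomposition of small cost has small coefficients, so that the
  combinations of the \<open>u j\<close> and of the \<open>v j\<close> in it are themselves small.
\<close>
lemma glued_norm_definite:
  assumes z: "z \<in> C \<times> D" and 0: "glued_norm z = 0"
  shows "z = 0"
proof -
  let ?U = "\<lambda>c. \<Sum>j\<in>J. c j *\<^sub>R u j" and ?V = "\<lambda>c. \<Sum>j\<in>J. c j *\<^sub>R v j"
  define M where "M = (\<Sum>j\<in>J. p (u j)) + (\<Sum>j\<in>J. q (v j))"
  have pu: "p (u j) \<le> M" and qv: "q (v j) \<le> M" if "j \<in> J" for j
    using member_le_sum[of j J "\<lambda>j. p (u j)"] member_le_sum[of j J "\<lambda>j. q (v j)"]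
      sum_nonneg[of J "\<lambda>j. p (u j)"] sum_nonneg[of J "\<lambda>j. q (v j)"] that J X.nonneg[OF u] Y.nonneg[OF v]
    unfolding M_def by force+
  have M: "0 \<le> M" unfolding M_def
    by (intro add_nonneg_nonneg sum_nonneg X.nonneg Y.nonneg u v)
  have bound: "p (fst z) \<le> cost z c * (1 + M / \<epsilon>)" "q (snd z) \<le> cost z c * (1 + M / \<epsilon>)" for c
  proof -
    have nn: "0 \<le> p (fst z - ?U c)" "0 \<le> q (snd z + ?V c)" "0 \<le> (\<Sum>j\<in>J. \<bar>c j\<bar>)"
      using z sum_u sum_v by (auto intro!: X.nonneg Y.nonneg sum_nonneg)
    then have 1: "p (fst z - ?U c) \<le> cost z c" "q (snd z + ?V c) \<le> cost z c"
      "\<epsilon> * (\<Sum>j\<in>J. \<bar>c j\<bar>) \<le> cost z c"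
      using \<epsilon> by (simp_all add: cost_def)
    have "(\<Sum>j\<in>J. \<bar>c j\<bar>) * M \<le> cost z c * (M / \<epsilon>)"
      using mult_right_mono[OF 1(3) M] \<epsilon> by (simp add: field_simps)
    moreover have "p (?U c) \<le> (\<Sum>j\<in>J. \<bar>c j\<bar> * p (u j))" using X.sum_le[OF J u] .
    moreover have "(\<Sum>j\<in>J. \<bar>c j\<bar> * p (u j)) \<le> (\<Sum>j\<in>J. \<bar>c j\<bar>) * M"
      unfolding sum_distrib_right using pu by (intro sum_mono mult_left_mono) auto
    moreover have "q (?V c) \<le> (\<Sum>j\<in>J. \<bar>c j\<bar> * q (v j))" using Y.sum_le[OF J v] .
    moreover have "(\<Sum>j\<in>J. \<bar>c j\<bar> * q (v j)) \<le> (\<Sum>j\<in>J. \<bar>c j\<bar>) * M"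
      unfolding sum_distrib_right using qv by (intro sum_mono mult_left_mono) auto
    moreover have "p (fst z) \<le> p (fst z - ?U c) + p (?U c)"
      using X.triangle[of "fst z - ?U c" "?U c"] z sum_u by auto
    moreover have "q (snd z) \<le> q (snd z + ?V c) + q (?V c)"
      using Y.diff_triangle[of "snd z" "- ?V c" 0] z sum_v Y.minus by auto
    ultimately show "p (fst z) \<le> cost z c * (1 + M / \<epsilon>)" "q (snd z) \<le> cost z c * (1 + M / \<epsilon>)"
      using 1 by (simp_all add: distrib_left)
  qed
  have pos: "0 < 1 + M / \<epsilon>" using M \<epsilon> by (intro add_pos_nonneg) auto
  have "p (fst z) / (1 + M / \<epsilon>) \<le> glued_norm z" "q (snd z) / (1 + M / \<epsilon>) \<le> glued_norm z"
    using bound pos by (intro glued_norm_ge; simp add: pos_divide_le_eq)+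
  then have "p (fst z) \<le> 0" "q (snd z) \<le> 0"
    using pos 0 by (simp_all add: divide_le_0_iff)
  then have "p (fst z) = 0" "q (snd z) = 0"
    using z X.nonneg[of "fst z"] Y.nonneg[of "snd z"] by (auto simp: mem_Times_iff)
  then show ?thesis
    using X.definite[of "fst z"] Y.definite[of "snd z"] z by (auto simp: mem_Times_iff prod_eq_iff)
qed

lemma glued_normed_space: "normed_space_on (C \<times> D) glued_norm"
  unfolding normed_space_on_def seminorm_on_def
proof (intro conjI ballI allI impI)
  show "subspace (C \<times> D)"
    by (rule subspace_Times[OF X.subspace_C Y.subspace_C])
  show "0 \<le> glued_norm z" if "z \<in> C \<times> D" for z
    using cost_nonneg[OF that] by (rule glued_norm_ge)
qed (auto intro: glued_norm_add glued_norm_scale glued_norm_definite)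

end

section \<open>Sections of a continuous field\<close>

lemma ou_norm_completion:
  assumes "ou_completion A E" and a: "a \<in> ou_carrier A"
  shows "ou_norm A a = ou_norm E a"
proof -
  interpret order_unit_carrier A
    by unfold_locales (use assms(1) in \<open>simp add: ou_completion_def\<close>)
  have "ou_unit E = ou_unit A" and "\<And>x y. x \<in> ou_carrier A \<Longrightarrow> y \<in> ou_carrier A \<Longrightarrow> ou_le E x y = ou_le A x y"
    using assms(1) by (auto simp: ou_completion_def)
  then show ?thesis unfolding ou_norm_def using a by simp
qed

lemma ennreal_tendsto_0I:
  fixes g :: "'a \<Rightarrow> ennreal"
  assumes "\<And>\<epsilon>. 0 < \<epsilon> \<Longrightarrow> \<forall>\<^sub>F x in F. g x \<le> ennreal \<epsilon>"
  shows "(g \<longlongrightarrow> 0) F"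
proof (rule order_tendstoI)
  fix a :: ennreal assume "0 < a"
  then obtain z where z: "0 < z" "z < a" using dense by blast
  then have zt: "z < top" by (meson less_le_trans top_greatest)
  then have "z = ennreal (enn2real z)" by simp
  moreover have "0 < enn2real z" using z zt by (simp add: enn2real_positive_iff)
  ultimately have "\<forall>\<^sub>F x in F. g x \<le> z" using assms[of "enn2real z"] by simp
  then show "\<forall>\<^sub>F x in F. g x < a" by eventually_elim (use z(2) in auto)
qed auto

locale cqms_field =
  fixes A E :: "'t::topological_space \<Rightarrow> 'v::real_vector ou_space"
    and L :: "'t \<Rightarrow> 'v \<Rightarrow> real"
    and \<Gamma> :: "('t \<Rightarrow> 'v) set"
  assumes field: "continuous_field_of_cqms A L E \<Gamma>"
begin

abbreviation "C t \<equiv> ou_carrier (E t)"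
abbreviation "n t \<equiv> ou_norm (E t)"

lemma completion: "ou_completion (A t) (E t)"
  and cqms: "compact_quantum_metric_space (A t) (L t)"
  and field_E: "continuous_field_of_ou_spaces E \<Gamma>"
  using field by (simp_all add: continuous_field_of_cqms_def)

lemma field_C: "continuous_field_of_banach_spaces C n \<Gamma>"
  and unit_section: "(\<lambda>t. ou_unit (E t)) \<in> \<Gamma>"
  using field_E by (simp_all add: continuous_field_of_ou_spaces_def)

sublocale fibre: normed_carrier "C t" "n t" for t
  using field_C by unfold_locales (simp add: continuous_field_of_banach_spaces_def banach_space_on_def)

sublocale space: order_unit_carrier "A t" for t
  using cqms by unfold_locales (simp add: compact_quantum_metric_space_def)

lemma carrier_le: "a \<in> ou_carrier (A t) \<Longrightarrow> a \<in> C t"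
  and unit_eq: "ou_unit (A t) = ou_unit (E t)"
  using completion[of t] by (auto simp: ou_completion_def)

lemma norm_eq: "a \<in> ou_carrier (A t) \<Longrightarrow> ou_norm (A t) a = n t a"
  by (rule ou_norm_completion[OF completion])

lemma lip_norm: "lip_norm (A t) (L t)"
  using cqms by (simp add: compact_quantum_metric_space_def)

abbreviation "D R t \<equiv> lip_ball R (A t) (L t)"

lemma D_iff: "a \<in> D R t \<longleftrightarrow> a \<in> ou_carrier (A t) \<and> L t a \<le> 1 \<and> n t a \<le> R"
  using norm_eq by (auto simp: lip_ball_def)

lemma D_carrier: "a \<in> D R t \<Longrightarrow> a \<in> C t"
  by (simp add: D_iff carrier_le)

lemma D_dist: "a \<in> D R t \<Longrightarrow> b \<in> D R t \<Longrightarrow> ou_norm (A t) (a - b) = n t (a - b)"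
  by (simp add: D_iff norm_eq)

lemma field_axioms:
  "\<forall>f\<in>\<Gamma>. \<forall>t. f t \<in> C t"
  "(\<lambda>t. 0) \<in> \<Gamma>"
  "\<forall>f\<in>\<Gamma>. \<forall>g\<in>\<Gamma>. (\<lambda>t. f t + g t) \<in> \<Gamma>"
  "\<forall>c. \<forall>f\<in>\<Gamma>. (\<lambda>t. c *\<^sub>R f t) \<in> \<Gamma>"
  "\<forall>f\<in>\<Gamma>. continuous_on UNIV (\<lambda>t. n t (f t))"
  using field_C unfolding continuous_field_of_banach_spaces_def by - (elim conjE, assumption)+

lemma section_in: "f \<in> \<Gamma> \<Longrightarrow> f t \<in> C t"
  using field_axioms(1) by blast

lemma section_zero: "(\<lambda>t. 0) \<in> \<Gamma>"
  by (rule field_axioms(2))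

lemma section_add: "f \<in> \<Gamma> \<Longrightarrow> g \<in> \<Gamma> \<Longrightarrow> (\<lambda>t. f t + g t) \<in> \<Gamma>"
  using field_axioms(3) by blast

lemma section_scale: "f \<in> \<Gamma> \<Longrightarrow> (\<lambda>t. c *\<^sub>R f t) \<in> \<Gamma>"
  using field_axioms(4) by blast

lemma section_norm: "f \<in> \<Gamma> \<Longrightarrow> continuous_on UNIV (\<lambda>t. n t (f t))"
  using field_axioms(5) by blast

lemma section_diff: "f \<in> \<Gamma> \<Longrightarrow> g \<in> \<Gamma> \<Longrightarrow> (\<lambda>t. f t - g t) \<in> \<Gamma>"
  using section_add[of f "\<lambda>t. (- 1) *\<^sub>R g t"] section_scale[of g "- 1"] by simp

lemma section_sum:
  assumes "finite J" "\<And>j. j \<in> J \<Longrightarrow> g j \<in> \<Gamma>"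
  shows "(\<lambda>t. \<Sum>j\<in>J. c j *\<^sub>R g j t) \<in> \<Gamma>"
  using assms
proof (induction J rule: finite_induct)
  case (insert i J)
  then show ?case
    using section_add[OF section_scale[of "g i" "c i"], of "\<lambda>t. \<Sum>j\<in>J. c j *\<^sub>R g j t"] by simp
qed (simp add: section_zero)

lemma norm_tendsto:
  assumes "f \<in> \<Gamma>"
  shows "((\<lambda>t. n t (f t)) \<longlongrightarrow> n t0 (f t0)) (nhds t0)"
  using section_norm[OF assms] tendsto_at_iff_tendsto_nhds[of "\<lambda>t. n t (f t)" t0]
  by (simp add: continuous_on_def)

lemma norm_eventually_less: "f \<in> \<Gamma> \<Longrightarrow> n t0 (f t0) < r \<Longrightarrow> \<forall>\<^sub>F t in nhds t0. n t (f t) < r"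
  and norm_eventually_greater: "f \<in> \<Gamma> \<Longrightarrow> r < n t0 (f t0) \<Longrightarrow> \<forall>\<^sub>F t in nhds t0. r < n t (f t)"
  using norm_tendsto order_tendstoD by blast+

text \<open>
  For a single coefficient vector this is continuity of the norm of a section.  By homogeneity only
  coefficients in \<open>[-1, 1]\<close> matter; there a finite grid \<open>G\<close> of mesh \<open>1 / k\<close> suffices, because the norm
  depends on the coefficients in a Lipschitz way, with a constant that is bounded near \<open>t0\<close>.
\<close>
lemma norm_of_combinations_uniformly_continuous:
  fixes J :: "'j set"
  assumes J: "finite J" and g: "\<And>j. j \<in> J \<Longrightarrow> g j \<in> \<Gamma>" and \<epsilon>: "0 < \<epsilon>"
  shows "\<forall>\<^sub>F t in nhds t0. \<forall>c. \<bar>n t (\<Sum>j\<in>J. c j *\<^sub>R g j t) - n t0 (\<Sum>j\<in>J. c j *\<^sub>R g j t0)\<bar>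
           \<le> \<epsilon> * (\<Sum>j\<in>J. \<bar>c j\<bar>)"
proof -
  define S where "S c t = (\<Sum>j\<in>J. c j *\<^sub>R g j t)" for c :: "'j \<Rightarrow> real" and t
  define M where "M t = (\<Sum>j\<in>J. n t (g j t))" for t
  have S_in: "S c t \<in> C t" for c t
    unfolding S_def using g section_in by (intro fibre.sum_mem) auto
  have S_le: "n t (S c t) \<le> r * M t" if "\<And>j. j \<in> J \<Longrightarrow> \<bar>c j\<bar> \<le> r" for c r t
  proof -
    have "n t (S c t) \<le> (\<Sum>j\<in>J. \<bar>c j\<bar> * n t (g j t))"
      unfolding S_def using J g section_in by (intro fibre.sum_le) auto
    also have "\<dots> \<le> r * M t"
      unfolding M_def sum_distrib_left using that g section_in fibre.nonneg
      by (intro sum_mono mult_right_mono) auto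
    finally show ?thesis .
  qed
  have M_nonneg: "0 \<le> M t0" unfolding M_def using g section_in fibre.nonneg by (intro sum_nonneg) auto
  obtain k :: nat where k: "4 * (M t0 + 1) / \<epsilon> < real k" using reals_Archimedean2 by blast
  have k0: "0 < real k" using k \<epsilon> M_nonneg by (smt (verit) divide_nonneg_pos)
  have k4: "(M t0 + 1) / real k < \<epsilon> / 4" using k \<epsilon> k0 by (simp add: field_simps)
  define G where "G = PiE J (\<lambda>_. (\<lambda>i. real_of_int i / real k) ` {- int k..int k})"
  have "finite G" unfolding G_def using J by (intro finite_PiE) auto
  moreover have "\<forall>\<^sub>F t in nhds t0. \<bar>n t (S d t) - n t0 (S d t0)\<bar> < \<epsilon> / 2" if "d \<in> G" for d
  proof -
    have "S d \<in> \<Gamma>" unfolding S_def[abs_def] using section_sum[OF J g] by simp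
    from tendstoD[OF norm_tendsto[OF this], of "\<epsilon> / 2"] \<epsilon> show ?thesis by (simp add: dist_real_def)
  qed
  ultimately have grid: "\<forall>\<^sub>F t in nhds t0. \<forall>d\<in>G. \<bar>n t (S d t) - n t0 (S d t0)\<bar> < \<epsilon> / 2"
    by (intro eventually_ball_finite) auto
  have "(M \<longlongrightarrow> M t0) (nhds t0)"
    unfolding M_def using norm_tendsto g by (intro tendsto_sum) auto
  then have "\<forall>\<^sub>F t in nhds t0. M t < M t0 + 1" by (rule order_tendstoD) simp
  with grid show ?thesis
  proof eventually_elim
    case (elim t)
    have small: "\<bar>n t (S c t) - n t0 (S c t0)\<bar> \<le> \<epsilon>" if c: "\<And>j. j \<in> J \<Longrightarrow> \<bar>c j\<bar> \<le> 1" for c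
    proof -
      define d where "d = restrict (\<lambda>j. real_of_int \<lfloor>c j * real k\<rfloor> / real k) J"
      have "\<lfloor>c j * real k\<rfloor> \<in> {- int k..int k}" if "j \<in> J" for j
      proof -
        have "\<bar>c j * real k\<bar> \<le> real k" using c[OF that] k0 by (simp add: abs_mult mult_le_cancel_right1)
        then show ?thesis by simp linarith
      qed
      then have "d \<in> G" unfolding d_def G_def by auto
      then have 1: "\<bar>n t (S d t) - n t0 (S d t0)\<bar> < \<epsilon> / 2" using elim by blast
      have cd: "\<bar>c j - d j\<bar> \<le> 1 / real k" if "j \<in> J" for j
      proof -
        have "\<bar>c j * real k - real_of_int \<lfloor>c j * real k\<rfloor>\<bar> \<le> 1" by linarith
        moreover have "c j - d j = (c j * real k - real_of_int \<lfloor>c j * real k\<rfloor>) / real k"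
          using that k0 by (simp add: d_def field_simps)
        ultimately show ?thesis using k0 by (simp add: divide_right_mono)
      qed
      have 2: "\<bar>n s (S c s) - n s (S d s)\<bar> \<le> \<epsilon> / 4" if "M s < M t0 + 1" for s
      proof -
        have "\<bar>n s (S c s) - n s (S d s)\<bar> \<le> n s (S c s - S d s)"
          by (intro fibre.abs_diff_le S_in)
        also have "S c s - S d s = S (\<lambda>j. c j - d j) s"
          by (simp add: S_def scaleR_left_diff_distrib sum_subtractf)
        also have "n s \<dots> \<le> (1 / real k) * M s" using cd by (rule S_le)
        also have "\<dots> \<le> \<epsilon> / 4" using that k4 k0 by (simp add: field_simps)
        finally show ?thesis .
      qed
      show ?thesis using 1 2[of t] 2[of t0] elim by linarith
    qed
    show ?case
    proof (intro allI)
      fix c :: "'j \<Rightarrow> real"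
      define s where "s = (\<Sum>j\<in>J. \<bar>c j\<bar>)"
      have le_s: "\<bar>c j\<bar> \<le> s" if "j \<in> J" for j
        unfolding s_def using that J by (intro member_le_sum) auto
      have "0 \<le> s" by (simp add: s_def sum_nonneg)
      have "\<bar>n t (S c t) - n t0 (S c t0)\<bar> \<le> \<epsilon> * s"
      proof (cases "s = 0")
        case True
        then have "S c t = 0" "S c t0 = 0" unfolding S_def using le_s by (auto intro!: sum.neutral)
        then show ?thesis using True by simp
      next
        case False
        with \<open>0 \<le> s\<close> have s: "0 < s" by simp
        have "S c r = s *\<^sub>R S (\<lambda>j. c j / s) r" for r
          using s by (simp add: S_def scaleR_sum_right)
        then have n: "n r (S c r) = s * n r (S (\<lambda>j. c j / s) r)" for r
          using fibre.scale[OF S_in, where c = s] s by simp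
        have "\<bar>n t (S (\<lambda>j. c j / s) t) - n t0 (S (\<lambda>j. c j / s) t0)\<bar> \<le> \<epsilon>"
          using le_s s by (intro small) simp
        then have "s * \<bar>n t (S (\<lambda>j. c j / s) t) - n t0 (S (\<lambda>j. c j / s) t0)\<bar> \<le> s * \<epsilon>"
          using s by (intro mult_left_mono) auto
        then show ?thesis
          unfolding n using s by (simp add: abs_mult mult.commute flip: right_diff_distrib)
      qed
      then show "\<bar>n t (\<Sum>j\<in>J. c j *\<^sub>R g j t) - n t0 (\<Sum>j\<in>J. c j *\<^sub>R g j t0)\<bar>
           \<le> \<epsilon> * (\<Sum>j\<in>J. \<bar>c j\<bar>)"
        by (simp add: S_def s_def)
    qed
  qed
qed

text \<open>
  Lower semicontinuity of the Lip-balls, which holds in every field.  The section \<open>f\<close> itself may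
  leave the carrier \<open>A t\<close>, but the field axiom offers a section \<open>g\<close> that is close to \<open>f\<close> at \<open>t0\<close> and
  whose Lip-norm is upper semicontinuous there.  Near \<open>t0\<close> both \<open>L t (g t)\<close> and the norm of \<open>g t\<close> exceed
  the bounds \<open>1\<close> and \<open>R\<close> by less than \<open>\<delta>\<close>, so shrinking \<open>g t\<close> by the factor \<open>l\<close> puts it into the
  Lip-ball.
\<close>
lemma section_stays_near_lip_ball:
  assumes f: "f \<in> \<Gamma>" "f t0 \<in> D R t0" and R: "0 \<le> R" and \<epsilon>: "0 < \<epsilon>"
  shows "\<forall>\<^sub>F t in nhds t0. \<exists>x\<in>D R t. n t (x - f t) < \<epsilon>"
proof -
  \<comment> \<open>The distance from \<open>f t\<close> to \<open>g t\<close> is below \<open>\<delta>\<close>, and shrinking \<open>g t\<close> costs at most \<open>\<delta> * (R + 1)\<close>.\<close>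
  define \<delta> where "\<delta> = \<epsilon> / (R + 2)"
  have \<delta>: "0 < \<delta>" "\<delta> * (R + 2) = \<epsilon>" using R \<epsilon> by (simp_all add: \<delta>_def)
  have f0: "f t0 \<in> ou_carrier (A t0)" "L t0 (f t0) \<le> 1" "n t0 (f t0) \<le> R"
    using f(2) by (auto simp: D_iff)
  obtain g where g: "g \<in> lip_sections A L \<Gamma> t0" "n t0 (g t0 - f t0) < \<delta>"
    "lip_ext (A t0) (L t0) (g t0) < ereal (L t0 (f t0) + \<delta>)"
    using field f0(1) \<delta>(1) unfolding continuous_field_of_cqms_def by blast
  have g\<Gamma>: "g \<in> \<Gamma>" using g(1) by (simp add: lip_sections_def)
  have "lip_ext (A t0) (L t0) (g t0) < ereal (1 + \<delta>)"
    using g(3) by (rule less_le_trans) (use f0(2) in simp)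
  then have L: "\<forall>\<^sub>F t in nhds t0. lip_ext (A t) (L t) (g t) < ereal (1 + \<delta>)"
    using g(1) by (auto simp: lip_sections_def usc_at_def)
  have "n t0 (g t0) \<le> n t0 (g t0 - f t0) + n t0 (f t0)"
    using fibre.triangle[of "g t0 - f t0" t0 "f t0"] section_in f(1) g\<Gamma> by simp
  then have "n t0 (g t0) < R + \<delta>" using g(2) f0(3) by linarith
  then have N: "\<forall>\<^sub>F t in nhds t0. n t (g t) < R + \<delta>" by (rule norm_eventually_less[OF g\<Gamma>])
  have D: "\<forall>\<^sub>F t in nhds t0. n t (g t - f t) < \<delta>"
    by (rule norm_eventually_less[OF section_diff[OF g\<Gamma> f(1)] g(2)])
  define l where "l = min (1 / (1 + \<delta>)) (R / (R + \<delta>))"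
  have l: "0 \<le> l" "l \<le> 1 / (1 + \<delta>)" "l \<le> R / (R + \<delta>)" "l \<le> 1"
    using \<delta>(1) R by (auto simp: l_def min_le_iff_disj)
  have l1: "l * (1 + \<delta>) \<le> 1" and lR: "l * (R + \<delta>) \<le> R"
    using l(2,3) \<delta>(1) R by (simp_all add: pos_le_divide_eq)
  have loss: "(1 - l) * (R + \<delta>) \<le> \<delta> * (R + 1)"
  proof (cases "l = R / (R + \<delta>)")
    case True
    then have "(1 - l) * (R + \<delta>) = \<delta>" using \<delta>(1) R by (simp add: field_simps)
    also have "\<dots> \<le> \<delta> * (R + 1)" using \<delta>(1) R by simp
    finally show ?thesis .
  next
    case False
    then have "l = 1 / (1 + \<delta>)" by (auto simp: l_def min_def split: if_splits)
    then have "1 - l = \<delta> / (1 + \<delta>)" using \<delta>(1) by (simp add: field_simps)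
    then have "(1 - l) * (R + \<delta>) = \<delta> * ((R + \<delta>) / (1 + \<delta>))" by simp
    also have "\<dots> \<le> \<delta> * (R + 1)"
      using \<delta>(1) R by (intro mult_left_mono) (simp_all add: pos_divide_le_eq algebra_simps)
    finally show ?thesis .
  qed
  from L N D show ?thesis
  proof eventually_elim
    case (elim t)
    have gt: "g t \<in> ou_carrier (A t)" "L t (g t) < 1 + \<delta>"
      using elim(1) by (auto simp: lip_ext_def split: if_splits)
    have C: "g t \<in> C t" "f t \<in> C t" using section_in g\<Gamma> f(1) by auto
    have "L t (l *\<^sub>R g t) = l * L t (g t)"
      using lip_norm[of t] gt(1) l(1) by (auto simp: lip_norm_def seminorm_on_def)
    also have "\<dots> \<le> l * (1 + \<delta>)" using gt(2) l(1) by (intro mult_left_mono) auto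
    finally have "L t (l *\<^sub>R g t) \<le> 1" using l1 by linarith
    moreover have "n t (l *\<^sub>R g t) \<le> l * (R + \<delta>)"
      using fibre.scale[OF C(1), of l] l(1) elim(2) by (simp add: mult_left_mono)
    then have "n t (l *\<^sub>R g t) \<le> R" using lR by linarith
    ultimately have "l *\<^sub>R g t \<in> D R t" using gt(1) by (simp add: D_iff)
    moreover have "n t (l *\<^sub>R g t - f t) < \<epsilon>"
    proof -
      have "n t (l *\<^sub>R g t - f t) \<le> n t (l *\<^sub>R g t - g t) + n t (g t - f t)"
        using C by (intro fibre.diff_triangle) auto
      also have "l *\<^sub>R g t - g t = (l - 1) *\<^sub>R g t" by (simp add: scaleR_left_diff_distrib)
      also have "n t \<dots> = (1 - l) * n t (g t)" using fibre.scale[OF C(1), of "l - 1"] l(4) by simp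
      also have "\<dots> \<le> (1 - l) * (R + \<delta>)" using elim(2) l(4) by (intro mult_left_mono) auto
      also have "\<dots> \<le> \<delta> * (R + 1)" by (rule loss)
      finally show ?thesis using elim(3) \<delta>(2) by (simp add: distrib_left)
    qed
    ultimately show ?case by blast
  qed
qed

section \<open>Equivalence of the three conditions\<close>

definition covered_by_sections :: "real \<Rightarrow> 't \<Rightarrow> (nat \<Rightarrow> 't \<Rightarrow> 'v) \<Rightarrow> bool" where
  "covered_by_sections R t0 f \<longleftrightarrow>
     (\<forall>\<epsilon>>0. \<exists>N. \<forall>\<^sub>F t in nhds t0. \<forall>x\<in>D R t. \<exists>i<N. n t (x - f i t) < \<epsilon>)"

text \<open>
  Choose an \<open>\<epsilon> / 2\<close>-separated set \<open>F\<close> of largest possible size in the Lip-ball over \<open>t0\<close>, and sections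
  of the given sequence that pass close to its points.  They remain separated at nearby \<open>t\<close> by a bit
  more than \<open>\<epsilon> / 2\<close>.  A point of the Lip-ball over \<open>t\<close> that is at least \<open>\<epsilon>\<close> away from all of them
  would give a separated set with one more element there, and the Gromov-Hausdorff approximation would
  carry it back to \<open>t0\<close>, against the choice of \<open>F\<close>.
\<close>
lemma covered_if_dist_GH_tendsto_0:
  assumes R: "0 \<le> R" and f: "\<And>i. f i \<in> \<Gamma>" "\<And>i. f i t0 \<in> D R t0"
    and dense: "\<And>a \<epsilon>. a \<in> D R t0 \<Longrightarrow> 0 < \<epsilon> \<Longrightarrow> \<exists>i. n t0 (f i t0 - a) < \<epsilon>"
    and gh: "((\<lambda>t. dist_GH (D R t) (\<lambda>x y. ou_norm (A t) (x - y))
               (D R t0) (\<lambda>x y. ou_norm (A t0) (x - y))) \<longlongrightarrow> 0) (at t0)"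
  shows "covered_by_sections R t0 f"
  unfolding covered_by_sections_def
proof (intro allI impI)
  fix \<epsilon> :: real assume \<epsilon>: "0 < \<epsilon>"
  define s where "s = \<epsilon> / 2"
  have s: "0 < s" using \<epsilon> by (simp add: s_def)
  define sep where "sep F \<longleftrightarrow> finite F \<and> F \<subseteq> D R t0 \<and> pairwise (\<lambda>x y. s < ou_norm (A t0) (x - y)) F" for F
  obtain K where "\<forall>F. sep F \<longrightarrow> card F \<le> K"
    using space.lip_ball_separated_card_bounded[OF lip_norm[of t0] s, of R]
    unfolding sep_def by auto
  moreover have "sep {}" by (simp add: sep_def)
  ultimately have "\<exists>F. sep F \<and> (\<forall>F'. sep F' \<longrightarrow> card F' \<le> card F)"
    by (intro ex_has_greatest_nat[of sep "{}" card "Suc K"]) (auto simp: less_Suc_eq_le)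
  then obtain F where F: "sep F" and max: "\<And>F'. sep F' \<Longrightarrow> card F' \<le> card F"
    by blast
  have FD: "finite F" "F \<subseteq> D R t0" and far: "\<And>x y. x \<in> F \<Longrightarrow> y \<in> F \<Longrightarrow> x \<noteq> y \<Longrightarrow> s < n t0 (x - y)"
    using F D_dist[of _ R t0] unfolding sep_def pairwise_def by (auto simp: subset_iff)
  \<comment> \<open>\<open>F\<close> is finite, so its separation exceeds \<open>s\<close> by a fixed margin.  Of this margin \<open>2 * \<eta>\<close> each are
      spent on passing to the sections, on returning to the Lip-ball over \<open>t\<close>, and on the transfer.\<close>
  obtain \<eta> where \<eta>: "0 < \<eta>" "10 * \<eta> \<le> \<epsilon>"
    and gap: "\<And>x y. x \<in> F \<Longrightarrow> y \<in> F \<Longrightarrow> x \<noteq> y \<Longrightarrow> s + 6 * \<eta> < n t0 (x - y)"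
  proof -
    define P where "P = insert \<epsilon> ((\<lambda>(x, y). n t0 (x - y) - s) ` {(x, y) \<in> F \<times> F. x \<noteq> y})"
    have "finite {(x, y) \<in> F \<times> F. x \<noteq> y}"
      by (rule finite_subset[of _ "F \<times> F"]) (use FD(1) in auto)
    then have P: "finite P" by (simp add: P_def)
    have pos: "0 < Min P" using P far \<epsilon> by (auto simp: P_def)
    have "Min P \<le> n t0 (x - y) - s" if "x \<in> F" "y \<in> F" "x \<noteq> y" for x y
      using P that by (intro Min_le) (auto simp: P_def)
    then have "s + 6 * (Min P / 10) < n t0 (x - y)" if "x \<in> F" "y \<in> F" "x \<noteq> y" for x y
      using that pos by force
    moreover have "Min P \<le> \<epsilon>" using P by (intro Min_le) (auto simp: P_def)
    ultimately show thesis using pos by (intro that[of "Min P / 10"]) auto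
  qed
  have "\<exists>i. n t0 (f i t0 - x) < \<eta>" if "x \<in> F" for x
    using dense[of x \<eta>] that FD(2) \<eta>(1) by blast
  then obtain i where i: "\<And>x. x \<in> F \<Longrightarrow> n t0 (f (i x) t0 - x) < \<eta>" by metis
  have far0: "s + 4 * \<eta> < n t0 (f (i x) t0 - f (i y) t0)" if xy: "x \<in> F" "y \<in> F" "x \<noteq> y" for x y
  proof -
    have C: "x \<in> C t0" "y \<in> C t0" "f (i x) t0 \<in> C t0" "f (i y) t0 \<in> C t0"
      using xy FD(2) D_carrier[of _ R t0] section_in f(1) by auto
    have "n t0 (x - y) \<le> n t0 (x - f (i x) t0) + n t0 (f (i x) t0 - f (i y) t0) + n t0 (f (i y) t0 - y)"
      using fibre.diff_triangle[OF C(1,3,2)] fibre.diff_triangle[OF C(3,4,2)] by linarith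
    then show ?thesis
      using gap[OF xy] i[OF xy(1)] i[OF xy(2)] fibre.diff_commute[OF C(1,3)] by linarith
  qed
  have "\<forall>\<^sub>F t in at t0. dist_GH (D R t) (\<lambda>x y. ou_norm (A t) (x - y))
      (D R t0) (\<lambda>x y. ou_norm (A t0) (x - y)) < ennreal \<eta>"
    using order_tendstoD(2)[OF gh, of "ennreal \<eta>"] \<eta>(1) by simp
  then have GH: "\<forall>\<^sub>F t in nhds t0. t \<noteq> t0 \<longrightarrow> dist_GH (D R t) (\<lambda>x y. ou_norm (A t) (x - y))
      (D R t0) (\<lambda>x y. ou_norm (A t0) (x - y)) < ennreal \<eta>"
    by (simp add: eventually_at_filter)
  have "\<forall>\<^sub>F t in nhds t0. s + 4 * \<eta> < n t (f (i x) t - f (i y) t)" if "x \<in> F" "y \<in> F" "x \<noteq> y" for x y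
    using that far0 f(1) by (intro norm_eventually_greater section_diff)
  then have "\<forall>\<^sub>F t in nhds t0. \<forall>x\<in>F. \<forall>y\<in>F. x \<noteq> y \<longrightarrow> s + 4 * \<eta> < n t (f (i x) t - f (i y) t)"
    using FD(1) by (intro eventually_ball_finite ballI) (auto simp: eventually_mono)
  moreover have "\<forall>\<^sub>F t in nhds t0. \<forall>x\<in>F. \<exists>z\<in>D R t. n t (z - f (i x) t) < \<eta>"
    using FD(1) section_stays_near_lip_ball[OF f R \<eta>(1)] by (intro eventually_ball_finite) auto
  ultimately have "\<forall>\<^sub>F t in nhds t0. \<forall>y\<in>D R t. \<exists>x\<in>F. n t (y - f (i x) t) < \<epsilon>"
    using GH
  proof eventually_elim
    case (elim t)
    obtain z where z: "\<And>x. x \<in> F \<Longrightarrow> z x \<in> D R t \<and> n t (z x - f (i x) t) < \<eta>"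
      using elim(2) by metis
    show ?case
    proof (rule ccontr)
      assume "\<not> ?case"
      then obtain y where y: "y \<in> D R t" and yfar: "\<And>x. x \<in> F \<Longrightarrow> \<epsilon> \<le> n t (y - f (i x) t)"
        by (auto simp: not_less)
      have zz: "s + 2 * \<eta> < n t (z x - z x')" if x: "x \<in> F" "x' \<in> F" "x \<noteq> x'" for x x'
      proof -
        have C: "z x \<in> C t" "z x' \<in> C t" "f (i x) t \<in> C t" "f (i x') t \<in> C t"
          using x z D_carrier[of _ R t] section_in f(1) by auto
        have "n t (f (i x) t - f (i x') t) \<le> n t (f (i x) t - z x) + n t (z x - z x') + n t (z x' - f (i x') t)"
          using fibre.diff_triangle[OF C(3,1,4)] fibre.diff_triangle[OF C(1,2,4)] by linarith
        moreover have "s + 4 * \<eta> < n t (f (i x) t - f (i x') t)" using elim(1) x by blast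
        ultimately show ?thesis
          using z[OF x(1)] z[OF x(2)] fibre.diff_commute[OF C(1,3)] by linarith
      qed
      have yz: "s + 2 * \<eta> < n t (y - z x)" if x: "x \<in> F" for x
      proof -
        have C: "y \<in> C t" "z x \<in> C t" "f (i x) t \<in> C t"
          using x y z D_carrier[of _ R t] section_in f(1) by auto
        show ?thesis
          using fibre.diff_triangle[OF C] yfar[OF x] z[OF x] \<eta> unfolding s_def by linarith
      qed
      have sep1: "pairwise (\<lambda>x y. s + 2 * \<eta> < ou_norm (A t) (x - y)) (insert y (z ` F))"
        unfolding pairwise_insert
      proof (intro conjI ballI allI impI)
        fix w assume "w \<in> z ` F \<and> w \<noteq> y"
        then obtain x where x: "x \<in> F" "w = z x" by blast
        then show "s + 2 * \<eta> < ou_norm (A t) (y - w)"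
          using yz[OF x(1)] z[OF x(1)] y D_dist[of _ R t] by simp
        then show "s + 2 * \<eta> < ou_norm (A t) (w - y)"
          using x z[OF x(1)] y D_dist[of _ R t] fibre.diff_commute[of y t w] D_carrier[of _ R t] by simp
      next
        show "pairwise (\<lambda>x y. s + 2 * \<eta> < ou_norm (A t) (x - y)) (z ` F)"
          unfolding pairwise_def using zz z D_dist[of _ R t] by fastforce
      qed
      have sub1: "insert y (z ` F) \<subseteq> D R t" using y z by auto
      have "inj_on z F"
      proof (rule inj_onI, rule ccontr)
        fix x x' assume "x \<in> F" "x' \<in> F" "z x = z x'" "x \<noteq> x'"
        then show False using zz[of x x'] s \<eta>(1) by simp
      qed
      moreover have "y \<notin> z ` F" using yz s \<eta>(1) by force
      ultimately have card1: "card (insert y (z ` F)) = Suc (card F)"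
        using FD(1) by (simp add: card_image)
      have "\<exists>F'. F' \<subseteq> D R t0 \<and> card F' = Suc (card F) \<and> pairwise (\<lambda>x y. s < ou_norm (A t0) (x - y)) F'"
      \<comment> \<open>The limit says nothing about \<open>t0\<close>, where however no transfer is necessary.\<close>
      proof (cases "t = t0")
        case True
        have "pairwise (\<lambda>x y. s < ou_norm (A t) (x - y)) (insert y (z ` F))"
          by (rule pairwise_mono[OF sep1]) (use \<eta>(1) in auto)
        then show ?thesis
          using sub1 card1 unfolding True by (intro exI[of _ "insert y (z ` F)"]) simp
      next
        case False
        then have "dist_GH (D R t) (\<lambda>x y. ou_norm (A t) (x - y))
            (D R t0) (\<lambda>x y. ou_norm (A t0) (x - y)) < ennreal \<eta>" using elim(3) by blast
        from separated_set_transfer[OF this sub1 sep1] s card1 show ?thesis by simp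
      qed
      then obtain F' where "sep F'" "card F' = Suc (card F)"
        unfolding sep_def by (metis card.infinite nat.distinct(1))
      then show False using max[of F'] by simp
    qed
  qed
  moreover obtain N where N: "\<And>x. x \<in> F \<Longrightarrow> i x < N"
    using finite_nat_set_iff_bounded[of "i ` F"] FD(1) by auto
  ultimately have "\<forall>\<^sub>F t in nhds t0. \<forall>y\<in>D R t. \<exists>i<N. n t (y - f i t) < \<epsilon>"
    by (elim eventually_mono) (use N in blast)
  then show "\<exists>N. \<forall>\<^sub>F t in nhds t0. \<forall>x\<in>D R t. \<exists>i<N. n t (x - f i t) < \<epsilon>" ..
qed

text \<open>
  Glue the fibres over \<open>t\<close> and \<open>t0\<close> along the values of finitely many sections.  Two points that are
  within \<open>\<eta>\<close> of the two values of one of these sections end up within \<open>3 * \<eta>\<close> of each other, and the unit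
  section takes care of the multiples \<open>R e\<close> of the units.
\<close>
lemma dist_oq_le_if_matched:
  assumes J: "finite J" and \<eta>: "0 < \<eta>" and R: "0 \<le> R"
    and g: "\<And>j. j \<in> J \<Longrightarrow> g j \<in> \<Gamma>"
    and iso: "\<And>c. \<bar>n t (\<Sum>j\<in>J. c j *\<^sub>R g j t) - n t0 (\<Sum>j\<in>J. c j *\<^sub>R g j t0)\<bar> \<le> \<eta> * (\<Sum>j\<in>J. \<bar>c j\<bar>)"
    and unit: "k \<in> J" "g k = (\<lambda>t. ou_unit (E t))"
    and X: "\<And>x. x \<in> D R t \<Longrightarrow> \<exists>y\<in>D R t0. \<exists>j\<in>J. n t (x - g j t) < \<eta> \<and> n t0 (g j t0 - y) < \<eta>"
    and Y: "\<And>y. y \<in> D R t0 \<Longrightarrow> \<exists>x\<in>D R t. \<exists>j\<in>J. n t (x - g j t) < \<eta> \<and> n t0 (g j t0 - y) < \<eta>"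
  shows "dist_oq R (A t) (L t) (A t0) (L t0) \<le> ennreal ((R + 3) * \<eta>)"
proof -
  interpret gluing "C t" "n t" "C t0" "n t0" J "\<lambda>j. g j t" "\<lambda>j. g j t0" \<eta>
    using J \<eta> g section_in iso by unfold_locales auto
  let ?h = "\<lambda>a::'v. (a, 0::'v)" and ?k = "\<lambda>b::'v. (0::'v, b)"
  have emb: "linear_isometric_embedding (A t) (C t \<times> C t0) glued_norm ?h"
    "linear_isometric_embedding (A t0) (C t \<times> C t0) glued_norm ?k"
    unfolding linear_isometric_embedding_def linear_on_carrier_def
    by (auto simp: carrier_le glued_norm_left glued_norm_right norm_eq)
  have close: "glued_norm (?h x - ?k y) \<le> (R + 3) * \<eta>"
    if xy: "x \<in> D R t" "y \<in> D R t0" and j: "j \<in> J" "n t (x - g j t) < \<eta>" "n t0 (g j t0 - y) < \<eta>" for x y j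
  proof -
    have C: "x \<in> C t" "g j t \<in> C t" "y \<in> C t0" "g j t0 \<in> C t0"
      using xy j g section_in D_carrier by auto
    have "?h x - ?k y = ?h (x - g j t) + ((g j t, - g j t0) + ?k (g j t0 - y))" by simp
    also have "glued_norm \<dots> \<le> glued_norm (?h (x - g j t)) + (glued_norm (g j t, - g j t0) + glued_norm (?k (g j t0 - y)))"
      using C by (intro order_trans[OF glued_norm_add] add_left_mono glued_norm_add) auto
    also have "\<dots> \<le> \<eta> + (\<eta> + \<eta>)"
      using j C glued_norm_pair[OF j(1)] by (intro add_mono) (auto simp: glued_norm_left glued_norm_right)
    also have "\<dots> \<le> (R + 3) * \<eta>" using R \<eta> by (simp add: distrib_right)
    finally show ?thesis .
  qed
  have "dist_H (\<lambda>x y. glued_norm (x - y)) (?h ` D R t) (?k ` D R t0) \<le> ennreal ((R + 3) * \<eta>)"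
  proof (rule dist_H_leI)
    show "\<exists>y\<in>?k ` D R t0. glued_norm (x - y) \<le> (R + 3) * \<eta>" if "x \<in> ?h ` D R t" for x
      using that X close by blast
    show "\<exists>x\<in>?h ` D R t. glued_norm (x - y) \<le> (R + 3) * \<eta>" if "y \<in> ?k ` D R t0" for y
      using that Y close by blast
  qed
  moreover have "glued_norm (?h (R *\<^sub>R ou_unit (A t)) - ?k (R *\<^sub>R ou_unit (A t0))) \<le> (R + 3) * \<eta>"
  proof -
    have "glued_norm (?h (R *\<^sub>R ou_unit (A t)) - ?k (R *\<^sub>R ou_unit (A t0))) = glued_norm (R *\<^sub>R (g k t, - g k t0))"
      by (simp add: unit(2) unit_eq)
    also have "\<dots> = R * glued_norm (g k t, - g k t0)"
      using glued_norm_scale[of "(g k t, - g k t0)" R] g[OF unit(1)] section_in R by simp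
    also have "\<dots> \<le> R * \<eta>" using glued_norm_pair[OF unit(1)] R by (intro mult_left_mono) auto
    also have "\<dots> \<le> (R + 3) * \<eta>" using \<eta> by (simp add: distrib_right)
    finally show ?thesis .
  qed
  ultimately have "max (dist_H (\<lambda>x y. glued_norm (x - y)) (?h ` D R t) (?k ` D R t0))
      (ennreal (glued_norm (?h (R *\<^sub>R ou_unit (A t)) - ?k (R *\<^sub>R ou_unit (A t0))))) \<le> ennreal ((R + 3) * \<eta>)"
    by (intro max.boundedI ennreal_leI)
  then show ?thesis
    using dist_oq_le[OF glued_normed_space space.subspace_C space.mem(6) emb(1)
        space.subspace_C space.mem(6) emb(2), of R "L t" "L t0"]
    by (rule order_trans[rotated])
qed

text \<open>
  The covering matches every point over \<open>t\<close> with a section.  Applied at \<open>t0\<close> it does the same for the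
  points over \<open>t0\<close>, and the section then stays near the Lip-ball over \<open>t\<close>.
\<close>
lemma dist_oq_tendsto_0_if_covered:
  assumes R: "0 \<le> R" and f: "\<And>i. f i \<in> \<Gamma>" "\<And>i. f i t0 \<in> D R t0" and cov: "covered_by_sections R t0 f"
  shows "((\<lambda>t. dist_oq R (A t) (L t) (A t0) (L t0)) \<longlongrightarrow> 0) (at t0)"
proof (rule ennreal_tendsto_0I)
  fix \<epsilon> :: real assume \<epsilon>: "0 < \<epsilon>"
  define \<eta> where "\<eta> = \<epsilon> / (R + 3)"
  have \<eta>: "0 < \<eta>" "(R + 3) * \<eta> = \<epsilon>" using \<epsilon> R by (simp_all add: \<eta>_def)
  obtain N where N: "\<forall>\<^sub>F t in nhds t0. \<forall>x\<in>D R t. \<exists>i<N. n t (x - f i t) < \<eta>"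
    using cov \<eta>(1) unfolding covered_by_sections_def by blast
  have N0: "\<forall>x\<in>D R t0. \<exists>i<N. n t0 (x - f i t0) < \<eta>"
    using eventually_nhds_x_imp_x[OF N] .
  \<comment> \<open>The unit section is put in front of the given sequence.\<close>
  define g where "g = case_nat (\<lambda>t. ou_unit (E t)) f"
  have g: "g j \<in> \<Gamma>" for j unfolding g_def using f(1) unit_section by (cases j) auto
  have "\<forall>\<^sub>F t in nhds t0. \<forall>i\<in>{..<N}. \<exists>x\<in>D R t. n t (x - f i t) < \<eta>"
    using section_stays_near_lip_ball[OF f R \<eta>(1)] by (intro eventually_ball_finite) auto
  moreover have "\<forall>\<^sub>F t in nhds t0. \<forall>c. \<bar>n t (\<Sum>j\<le>N. c j *\<^sub>R g j t) - n t0 (\<Sum>j\<le>N. c j *\<^sub>R g j t0)\<bar>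
      \<le> \<eta> * (\<Sum>j\<le>N. \<bar>c j\<bar>)"
    using g \<eta>(1) by (intro norm_of_combinations_uniformly_continuous) auto
  ultimately have "\<forall>\<^sub>F t in nhds t0. dist_oq R (A t) (L t) (A t0) (L t0) \<le> ennreal ((R + 3) * \<eta>)"
    using N
  proof eventually_elim
    case (elim t)
    show ?case
    proof (rule dist_oq_le_if_matched[where J = "{..N}" and g = g and k = 0])
      fix x assume "x \<in> D R t"
      then obtain i where i: "i < N" "n t (x - f i t) < \<eta>" using elim(3) by blast
      then show "\<exists>y\<in>D R t0. \<exists>j\<in>{..N}. n t (x - g j t) < \<eta> \<and> n t0 (g j t0 - y) < \<eta>"
        using f(2)[of i] \<eta>(1) by (intro bexI[of _ "f i t0"] bexI[of _ "Suc i"]) (auto simp: g_def)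
    next
      fix y assume y: "y \<in> D R t0"
      then obtain i where i: "i < N" "n t0 (y - f i t0) < \<eta>" using N0 by blast
      then obtain x where x: "x \<in> D R t" "n t (x - f i t) < \<eta>" using elim(1) by blast
      have "n t0 (f i t0 - y) < \<eta>"
        using i(2) fibre.diff_commute[of y t0 "f i t0"] D_carrier[OF y] section_in[OF f(1)] by simp
      with i x show "\<exists>x\<in>D R t. \<exists>j\<in>{..N}. n t (x - g j t) < \<eta> \<and> n t0 (g j t0 - y) < \<eta>"
        by (intro bexI[of _ x] bexI[of _ "Suc i"]) (auto simp: g_def)
    qed (use elim(2) g R \<eta>(1) in \<open>auto simp: g_def\<close>)
  qed
  then show "\<forall>\<^sub>F t in at t0. dist_oq R (A t) (L t) (A t0) (L t0) \<le> ennreal \<epsilon>"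
    unfolding \<eta>(2) by (rule filter_leD[OF at_within_le_nhds])
qed

end

theorem theorem7p1:
  fixes A E :: "'t::t2_space \<Rightarrow> 'v::real_vector ou_space"
    and L :: "'t \<Rightarrow> 'v \<Rightarrow> real"
    and \<Gamma> :: "('t \<Rightarrow> 'v) set"
    and R :: real
    and t0 :: 't
    and f :: "nat \<Rightarrow> 't \<Rightarrow> 'v"
  assumes T: "locally_compact_space (euclidean :: 't topology)"
    and field: "continuous_field_of_cqms A L E \<Gamma>"
    and R: "R \<ge> 0"
    and f_sections: "\<And>n. f n \<in> \<Gamma>"
    and f_lip_ball: "\<And>n. f n t0 \<in> lip_ball R (A t0) (L t0)"
    and f_dense: "\<And>a \<epsilon>. a \<in> lip_ball R (A t0) (L t0) \<Longrightarrow> \<epsilon> > 0 \<Longrightarrow>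
                    \<exists>n. ou_norm (A t0) (f n t0 - a) < \<epsilon>"
  shows "(((\<lambda>t. dist_oq R (A t) (L t) (A t0) (L t0)) \<longlongrightarrow> 0) (at t0)
          \<longleftrightarrow>
          ((\<lambda>t. dist_GH (lip_ball R (A t) (L t)) (\<lambda>x y. ou_norm (A t) (x - y))
                        (lip_ball R (A t0) (L t0)) (\<lambda>x y. ou_norm (A t0) (x - y))) \<longlongrightarrow> 0) (at t0))
         \<and>
         (((\<lambda>t. dist_GH (lip_ball R (A t) (L t)) (\<lambda>x y. ou_norm (A t) (x - y))
                        (lip_ball R (A t0) (L t0)) (\<lambda>x y. ou_norm (A t0) (x - y))) \<longlongrightarrow> 0) (at t0)
          \<longleftrightarrow>
          (\<forall>\<epsilon>>0. \<exists>N. \<exists>U. open U \<and> t0 \<in> U \<and>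
             (\<forall>t\<in>U. lip_ball R (A t) (L t) \<subseteq>
                (\<Union>n<N. {x \<in> ou_carrier (E t). ou_norm (E t) (x - f n t) < \<epsilon>}))))"
    (is "(?i \<longleftrightarrow> ?ii) \<and> (?ii \<longleftrightarrow> ?iii)")
proof -
  interpret cqms_field A E L \<Gamma> by unfold_locales (rule field)
  have "D R t \<subseteq> (\<Union>i<N. {x \<in> C t. n t (x - f i t) < \<epsilon>}) \<longleftrightarrow>
      (\<forall>x\<in>D R t. \<exists>i<N. n t (x - f i t) < \<epsilon>)" for N t \<epsilon>
    using D_carrier[of _ R t] by (auto simp: subset_iff)
  then have "?iii \<longleftrightarrow> covered_by_sections R t0 f"
    unfolding covered_by_sections_def eventually_nhds by simp
  moreover have "?ii" if "?i"
    using that by (rule tendsto_sandwich[OF _ _ tendsto_const, rotated 2])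
      (auto intro!: always_eventually dist_GH_le_dist_oq space.subspace_C)
  moreover have "covered_by_sections R t0 f" if "?ii"
  proof (rule covered_if_dist_GH_tendsto_0[OF R f_sections f_lip_ball _ that])
    fix a \<epsilon> assume "a \<in> D R t0" "(0::real) < \<epsilon>"
    then show "\<exists>i. n t0 (f i t0 - a) < \<epsilon>"
      using f_dense[of a \<epsilon>] D_dist[OF f_lip_ball] by auto
  qed
  moreover have "?i" if "covered_by_sections R t0 f"
    using dist_oq_tendsto_0_if_covered[OF R f_sections f_lip_ball that] .
  ultimately show ?thesis by blast
qed

end
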